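(* Let $g=C\left(\frac{1}{4F}dz^2+F(\eta^1)^2+(\eta^2)^2+(\eta^3)^2\right)$ with $F=F(z)>0$, $C=C(z)>0$. Then $g$ has scalar curvature $s=s_0$ if and only if $F$, $C$ satisfy the second order relation $$0=s_0C^{\frac32}+4C^{\frac12}\left(\frac{\partial^2F}{\partial z^2}+\frac12F-2\right)+24\frac{\partial}{\partial z}\left(F\frac{\partial C^{\frac12}}{\partial z}\right),$$ and $g$ has $\delta W^\pm=0$ if and only if $e^{\pm\frac32z}(\mathcal{L}^\pm(F)-1)\sqrt C$ is constant. Suppose $g$ is K\"ahler with respect to $J^+$, meaning $C=C_0e^{-z}$ with $C_0>0$ constant. Then $\delta W^+=0$ if and only if $F=1+C_2e^{-z}+C_3e^{z}+\frac12C_4e^{2z}$ for some real constants $C_2,C_3,C_4$, in which case the scalar curvature is the constant $s=-24C_2/C_0$. Likewise $\delta W^-=0$ if and only if $F=1+\frac12C_1e^{-2z}+C_2e^{-z}+\frac12C_4e^{2z}$ for some real constants $C_1,C_2,C_4$, in which case the metric is extremal K\"ahler and $s=-\frac{24}{C_0}(C_1e^{-z}+C_2)$.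
   Context: Let $\eta^1,\eta^2,\eta^3$ be the left-invariant coframe on $\mathbb{S}^3$ with $d\eta^1=-2\eta^2\wedge\eta^3$ and cyclic permutations, with dual frame $e_1,e_2,e_3$. The metric lives on $I\times\mathbb{S}^3$, $I$ an interval with coordinate $z$. Complex structures: $J^\pm=\mp2F\frac{\partial}{\partial z}\otimes\eta^1\pm\frac1{2F}e_1\otimes dz-e_2\otimes\eta^3+e_3\otimes\eta^2$, with $\omega^\pm=g(J^\pm\cdot,\cdot)$. The orientation is that of $J^+$, so $\omega^\pm\in\bigwedge^\pm$; $W^\pm$ are the self-dual/anti-self-dual Weyl tensors and $\delta$ is the divergence. Operators: $\mathcal{L}^+=\left(-\frac12\frac{d}{dz}+1\right)\left(-\frac{d}{dz}+1\right)$, $\mathcal{L}^-=\left(\frac12\frac{d}{dz}+1\right)\left(\frac{d}{dz}+1\right)$. A K\"ahler metric is extremal if it is critical for $\int s^2\,dVol$ under variations preserving the K\"ahler class; equivalently $J\nabla s$ is Killing. *)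

theory Defs
  imports "HOL-Analysis.Analysis"
begin

section \<open>The manifold and its global frame\<close>

text \<open>
  The three-sphere is the unit sphere of \<open>complex \<times> complex\<close>, the pair \<open>(u, v)\<close> standing for the
  quaternion \<open>u + v j\<close>. The left-invariant fields \<open>e\<^sub>1, e\<^sub>2, e\<^sub>3\<close> are right multiplication by
  \<open>i, j, k\<close>. Frame indices have type \<open>4\<close>: the index 0 is the coordinate field of \<open>z\<close> (dual to
  \<open>dz\<close>), and 1, 2, 3 are \<open>e\<^sub>1, e\<^sub>2, e\<^sub>3\<close> (dual to \<open>\<eta>\<^sup>1, \<eta>\<^sup>2, \<eta>\<^sup>3\<close>). All tensor fields are given by
  their components in this global frame.
\<close>

type_synonym point = "real \<times> complex \<times> complex"

definition I_times_S3 :: "real set \<Rightarrow> point set" where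
  "I_times_S3 I = I \<times> sphere 0 1"

definition inv_field :: "4 \<Rightarrow> complex \<times> complex \<Rightarrow> complex \<times> complex" where
  "inv_field a q =
     (if a = 1 then (\<i> * fst q, - \<i> * snd q)
      else if a = 2 then (- snd q, fst q)
      else if a = 3 then (\<i> * snd q, \<i> * fst q)
      else 0)"

text \<open>The integral curve of \<open>e\<^sub>a\<close> through \<open>q\<close> is the great circle \<open>q (cos t + sin t a)\<close>.\<close>

definition frame_flow :: "4 \<Rightarrow> real \<Rightarrow> point \<Rightarrow> point" where
  "frame_flow a t p =
     (if a = 0 then (fst p + t, snd p)
      else (fst p, cos t *\<^sub>R snd p + sin t *\<^sub>R inv_field a (snd p)))"

definition frame_deriv :: "4 \<Rightarrow> (point \<Rightarrow> real) \<Rightarrow> point \<Rightarrow> real" where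
  "frame_deriv a f p = deriv (\<lambda>t. f (frame_flow a t p)) 0"

text \<open>
  \<open>[e\<^sub>a, e\<^sub>b] = (\<Sum>c. struct_const a b c e\<^sub>c)\<close>; equivalently \<open>d\<eta>\<^sup>c(e\<^sub>a, e\<^sub>b) = - struct_const a b c\<close>, which is
  \<open>d\<eta>\<^sup>1 = -2 \<eta>\<^sup>2 \<and> \<eta>\<^sup>3\<close> and its cyclic permutations.
\<close>

definition struct_const :: "4 \<Rightarrow> 4 \<Rightarrow> 4 \<Rightarrow> real" where
  "struct_const a b c =
     (if (a, b, c) \<in> {(1, 2, 3), (2, 3, 1), (3, 1, 2)} then 2
      else if (b, a, c) \<in> {(1, 2, 3), (2, 3, 1), (3, 1, 2)} then -2
      else 0)"

text \<open>
  The bracket of linear vector fields \<open>q \<mapsto> A q\<close> and \<open>q \<mapsto> B q\<close> is \<open>q \<mapsto> B (A q) - A (B q)\<close>.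
\<close>

lemma inv_field_bracket:
  assumes "a \<noteq> 0" "b \<noteq> 0"
  shows "inv_field b (inv_field a q) - inv_field a (inv_field b q)
           = (\<Sum>c\<in>UNIV. struct_const a b c *\<^sub>R inv_field c q)"
proof -
  have "\<forall>a b. a \<noteq> 0 \<longrightarrow> b \<noteq> 0 \<longrightarrow>
      inv_field b (inv_field a q) - inv_field a (inv_field b q)
        = (\<Sum>c\<in>UNIV. struct_const a b c *\<^sub>R inv_field c q)"
    unfolding forall_4 sum_4
    by (cases q) (simp add: inv_field_def struct_const_def zero_prod_def algebra_simps scaleR_conv_of_real)
  with assms show ?thesis by blast
qed


section \<open>Riemannian geometry in the frame\<close>

type_synonym vfield = "point \<Rightarrow> real ^ 4"
type_synonym matfield = "point \<Rightarrow> real ^ 4 ^ 4"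
type_synonym tensor4 = "point \<Rightarrow> 4 \<Rightarrow> 4 \<Rightarrow> 4 \<Rightarrow> 4 \<Rightarrow> real"

definition lie_bracket :: "vfield \<Rightarrow> vfield \<Rightarrow> vfield" where
  "lie_bracket X Y p = (\<chi> c.
     (\<Sum>a\<in>UNIV. X p $ a * frame_deriv a (\<lambda>q. Y q $ c) p - Y p $ a * frame_deriv a (\<lambda>q. X q $ c) p)
     + (\<Sum>a\<in>UNIV. \<Sum>b\<in>UNIV. X p $ a * Y p $ b * struct_const a b c))"

text \<open>
  In what follows \<open>g p $ a $ b = g(e\<^sub>a, e\<^sub>b)\<close> at \<open>p\<close>. The Levi-Civita connection is given by the Koszul
  formula, \<open>koszul g p a b d = 2 g(\<nabla>\<^bsub>e\<^sub>a\<^esub> e\<^sub>b, e\<^sub>d)\<close> and \<open>\<nabla>\<^bsub>e\<^sub>a\<^esub> e\<^sub>b = (\<Sum>c. conn g p a b c e\<^sub>c)\<close>.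
\<close>

definition koszul :: "matfield \<Rightarrow> point \<Rightarrow> 4 \<Rightarrow> 4 \<Rightarrow> 4 \<Rightarrow> real" where
  "koszul g p a b d =
     frame_deriv a (\<lambda>q. g q $ b $ d) p + frame_deriv b (\<lambda>q. g q $ a $ d) p
     - frame_deriv d (\<lambda>q. g q $ a $ b) p
     + (\<Sum>f\<in>UNIV. struct_const a b f * g p $ f $ d - struct_const a d f * g p $ f $ b
                 - struct_const b d f * g p $ f $ a)"

definition conn :: "matfield \<Rightarrow> point \<Rightarrow> 4 \<Rightarrow> 4 \<Rightarrow> 4 \<Rightarrow> real" where
  "conn g p a b c = (1/2) * (\<Sum>d\<in>UNIV. koszul g p a b d * matrix_inv (g p) $ d $ c)"

text \<open>\<open>conn\<close> is metric and torsion-free, hence the Levi-Civita connection.\<close>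

lemma conn_lower:
  assumes "invertible (g p)"
  shows "(\<Sum>c\<in>UNIV. conn g p a b c * g p $ c $ d) = koszul g p a b d / 2"
proof -
  have inv: "matrix_inv (g p) ** g p = mat 1"
    using assms by (auto simp: invertible_def matrix_inv_def intro: someI2)
  have "(\<Sum>c\<in>UNIV. conn g p a b c * g p $ c $ d)
      = (\<Sum>c\<in>UNIV. \<Sum>e\<in>UNIV. (koszul g p a b e / 2) * (matrix_inv (g p) $ e $ c * g p $ c $ d))"
    unfolding conn_def by (simp add: sum_distrib_left sum_distrib_right mult_ac)
  also have "\<dots> = (\<Sum>e\<in>UNIV. (koszul g p a b e / 2) * (matrix_inv (g p) ** g p) $ e $ d)"
    by (subst sum.swap) (simp add: matrix_matrix_mult_def sum_distrib_left)
  also have "\<dots> = (\<Sum>e\<in>UNIV. if e = d then koszul g p a b e / 2 else 0)"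
    unfolding inv by (rule sum.cong) (auto simp: mat_def)
  finally show ?thesis by simp
qed

lemma conn_metric:
  assumes "invertible (g p)" and symm: "\<And>q. transpose (g q) = g q"
  shows "frame_deriv a (\<lambda>q. g q $ b $ d) p
           = (\<Sum>c\<in>UNIV. conn g p a b c * g p $ c $ d + conn g p a d c * g p $ b $ c)"
proof -
  have s: "g q $ i $ j = g q $ j $ i" for q i j
    by (subst symm[of q, symmetric]) (simp add: transpose_def)
  have sk: "struct_const i j k = - struct_const j i k" for i j k
    by (auto simp: struct_const_def)
  have "(\<Sum>c\<in>UNIV. conn g p a d c * g p $ b $ c) = (\<Sum>c\<in>UNIV. conn g p a d c * g p $ c $ b)"
    by (rule sum.cong) (simp_all only: s[of p b])
  then have "(\<Sum>c\<in>UNIV. conn g p a b c * g p $ c $ d + conn g p a d c * g p $ b $ c)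
      = koszul g p a b d / 2 + koszul g p a d b / 2"
    by (simp only: sum.distrib conn_lower[where g = g and p = p, OF assms(1)])
  also have "\<dots> = frame_deriv a (\<lambda>q. g q $ b $ d) p"
    unfolding koszul_def sk[of d b] s[of _ d b] s[of _ d a] s[of _ b a]
    by (simp add: sum.distrib sum_subtractf sum_negf field_simps)
  finally show ?thesis by (rule HOL.sym)
qed

lemma conn_torsion_free:
  assumes "invertible (g p)" and symm: "\<And>q. transpose (g q) = g q"
  shows "conn g p a b c - conn g p b a c = struct_const a b c"
proof -
  have s: "g q $ i $ j = g q $ j $ i" for q i j
    by (subst symm[of q, symmetric]) (simp add: transpose_def)
  have sk: "struct_const i j k = - struct_const j i k" for i j k
    by (auto simp: struct_const_def)
  have inv: "g p ** matrix_inv (g p) = mat 1"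
    using assms by (auto simp: invertible_def matrix_inv_def intro: someI2)
  have k: "koszul g p a b d - koszul g p b a d = 2 * (\<Sum>f\<in>UNIV. struct_const a b f * g p $ f $ d)" for d
    unfolding koszul_def sk[of b a] s[of _ b a] by (simp add: sum_subtractf sum_negf)
  have "conn g p a b c - conn g p b a c
      = (1/2) * (\<Sum>d\<in>UNIV. (koszul g p a b d - koszul g p b a d) * matrix_inv (g p) $ d $ c)"
    by (simp add: conn_def left_diff_distrib sum_subtractf right_diff_distrib)
  also have "\<dots> = (\<Sum>d\<in>UNIV. \<Sum>f\<in>UNIV. struct_const a b f * (g p $ f $ d * matrix_inv (g p) $ d $ c))"
    unfolding k by (simp add: sum_distrib_left sum_distrib_right mult_ac)
  also have "\<dots> = (\<Sum>f\<in>UNIV. struct_const a b f * (g p ** matrix_inv (g p)) $ f $ c)"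
    by (subst sum.swap) (simp add: matrix_matrix_mult_def sum_distrib_left)
  also have "\<dots> = (\<Sum>f\<in>UNIV. if f = c then struct_const a b f else 0)"
    unfolding inv by (rule sum.cong) (auto simp: mat_def)
  finally show ?thesis by simp
qed

text \<open>
  \<open>R(e\<^sub>a, e\<^sub>b) e\<^sub>c = (\<Sum>d. curv g p a b c d e\<^sub>d)\<close> with
  \<open>R(X, Y) = \<nabla>\<^sub>X \<nabla>\<^sub>Y - \<nabla>\<^sub>Y \<nabla>\<^sub>X - \<nabla>\<^bsub>[X,Y]\<^esub>\<close>, and \<open>riem g p a b c d = g(R(e\<^sub>a, e\<^sub>b) e\<^sub>d, e\<^sub>c)\<close>,
  so that \<open>riem g p a b a b\<close> is positive on round spheres.
\<close>

definition curv :: "matfield \<Rightarrow> tensor4" where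
  "curv g p a b c d =
     frame_deriv a (\<lambda>q. conn g q b c d) p - frame_deriv b (\<lambda>q. conn g q a c d) p
     + (\<Sum>f\<in>UNIV. conn g p b c f * conn g p a f d - conn g p a c f * conn g p b f d
                 - struct_const a b f * conn g p f c d)"

definition riem :: "matfield \<Rightarrow> tensor4" where
  "riem g p a b c d = (\<Sum>f\<in>UNIV. g p $ c $ f * curv g p a b d f)"

definition ric :: "matfield \<Rightarrow> point \<Rightarrow> 4 \<Rightarrow> 4 \<Rightarrow> real" where
  "ric g p b d = (\<Sum>a\<in>UNIV. curv g p a b d a)"

definition scal :: "matfield \<Rightarrow> point \<Rightarrow> real" where
  "scal g p = (\<Sum>b\<in>UNIV. \<Sum>d\<in>UNIV. matrix_inv (g p) $ b $ d * ric g p b d)"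

definition weyl :: "matfield \<Rightarrow> tensor4" where
  "weyl g p a b c d = riem g p a b c d
     - (1/2) * (g p $ a $ c * ric g p b d - g p $ a $ d * ric g p b c
              - g p $ b $ c * ric g p a d + g p $ b $ d * ric g p a c)
     + (scal g p / 6) * (g p $ a $ c * g p $ b $ d - g p $ a $ d * g p $ b $ c)"

text \<open>
  The volume form for the orientation in which \<open>(e\<^sub>0, e\<^sub>1, e\<^sub>2, e\<^sub>3)\<close> is positive; the determinant is the
  permutation symbol. This is the orientation of the complex structure \<open>J\<^sup>+\<close>, see
  \<open>cplx_struct_oriented\<close> below.
\<close>

definition vol_form :: "matfield \<Rightarrow> tensor4" where
  "vol_form g p a b c d = sqrt (det (g p)) *
     det ((\<chi> i. axis (if i = 0 then a else if i = 1 then b else if i = 2 then c else d) 1) :: real ^ 4 ^ 4)"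

text \<open>Hodge star on the first pair of indices: \<open>(\<star>T)\<^bsub>abcd\<^esub> = 1/2 vol\<^bsub>ab\<^esub>\<^bsup>ef\<^esup> T\<^bsub>efcd\<^esub>\<close>.\<close>

definition hodge :: "matfield \<Rightarrow> tensor4 \<Rightarrow> tensor4" where
  "hodge g T p a b c d = (1/2) *
     (\<Sum>i\<in>UNIV. \<Sum>j\<in>UNIV. \<Sum>e\<in>UNIV. \<Sum>f\<in>UNIV.
        vol_form g p a b i j * matrix_inv (g p) $ i $ e * matrix_inv (g p) $ j $ f * T p e f c d)"

definition weyl_plus :: "matfield \<Rightarrow> tensor4" where
  "weyl_plus g p a b c d = (1/2) * (weyl g p a b c d + hodge g (weyl g) p a b c d)"

definition weyl_minus :: "matfield \<Rightarrow> tensor4" where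
  "weyl_minus g p a b c d = (1/2) * (weyl g p a b c d - hodge g (weyl g) p a b c d)"

definition cov_deriv :: "matfield \<Rightarrow> tensor4 \<Rightarrow> point \<Rightarrow> 4 \<Rightarrow> 4 \<Rightarrow> 4 \<Rightarrow> 4 \<Rightarrow> 4 \<Rightarrow> real" where
  "cov_deriv g T p e a b c d = frame_deriv e (\<lambda>q. T q a b c d) p
     - (\<Sum>f\<in>UNIV. conn g p e a f * T p f b c d + conn g p e b f * T p a f c d
                 + conn g p e c f * T p a b f d + conn g p e d f * T p a b c f)"

definition divergence :: "matfield \<Rightarrow> tensor4 \<Rightarrow> point \<Rightarrow> 4 \<Rightarrow> 4 \<Rightarrow> 4 \<Rightarrow> real" where
  "divergence g T p b c d =
     (\<Sum>e\<in>UNIV. \<Sum>a\<in>UNIV. matrix_inv (g p) $ e $ a * cov_deriv g T p e a b c d)"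

definition divergence_free_on :: "point set \<Rightarrow> matfield \<Rightarrow> tensor4 \<Rightarrow> bool" where
  "divergence_free_on M g T \<longleftrightarrow> (\<forall>p\<in>M. \<forall>b c d. divergence g T p b c d = 0)"

definition gradient :: "matfield \<Rightarrow> (point \<Rightarrow> real) \<Rightarrow> vfield" where
  "gradient g f p = (\<chi> a. \<Sum>b\<in>UNIV. matrix_inv (g p) $ a $ b * frame_deriv b f p)"

text \<open>Vanishing of the Lie derivative of \<open>g\<close> along \<open>X\<close>, evaluated on the frame.\<close>

definition killing_on :: "point set \<Rightarrow> matfield \<Rightarrow> vfield \<Rightarrow> bool" where
  "killing_on M g X \<longleftrightarrow> (\<forall>p\<in>M. \<forall>a b.
     (\<Sum>c\<in>UNIV. X p $ c * frame_deriv c (\<lambda>q. g q $ a $ b) p)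
     - (\<Sum>c\<in>UNIV. lie_bracket X (\<lambda>_. axis a 1) p $ c * g p $ c $ b)
     - (\<Sum>c\<in>UNIV. lie_bracket X (\<lambda>_. axis b 1) p $ c * g p $ a $ c) = 0)"


section \<open>Kaehler and extremal Kaehler metrics\<close>

text \<open>An endomorphism field acts by \<open>J e\<^sub>b = (\<Sum>a. J p $ a $ b e\<^sub>a)\<close>, that is, by \<open>J p *v _\<close>.\<close>

definition nijenhuis :: "matfield \<Rightarrow> vfield \<Rightarrow> vfield \<Rightarrow> vfield" where
  "nijenhuis J X Y p =
     lie_bracket (\<lambda>q. J q *v X q) (\<lambda>q. J q *v Y q) p
     - J p *v lie_bracket (\<lambda>q. J q *v X q) Y p
     - J p *v lie_bracket X (\<lambda>q. J q *v Y q) p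
     - lie_bracket X Y p"

text \<open>\<open>\<omega>(e\<^sub>a, e\<^sub>b) = g(J e\<^sub>a, e\<^sub>b)\<close>\<close>

definition fund_form :: "matfield \<Rightarrow> matfield \<Rightarrow> matfield" where
  "fund_form g J p = (\<chi> a b. \<Sum>c\<in>UNIV. J p $ c $ a * g p $ c $ b)"

definition ext_deriv2 :: "matfield \<Rightarrow> point \<Rightarrow> 4 \<Rightarrow> 4 \<Rightarrow> 4 \<Rightarrow> real" where
  "ext_deriv2 w p a b c =
     frame_deriv a (\<lambda>q. w q $ b $ c) p + frame_deriv b (\<lambda>q. w q $ c $ a) p
     + frame_deriv c (\<lambda>q. w q $ a $ b) p
     - (\<Sum>f\<in>UNIV. struct_const a b f * w p $ f $ c + struct_const b c f * w p $ f $ a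
                 + struct_const c a f * w p $ f $ b)"

definition kaehler_on :: "point set \<Rightarrow> matfield \<Rightarrow> matfield \<Rightarrow> bool" where
  "kaehler_on M g J \<longleftrightarrow> (\<forall>p\<in>M.
     J p ** J p = - mat 1 \<and>
     transpose (J p) ** g p ** J p = g p \<and>
     (\<forall>a b. nijenhuis J (\<lambda>_. axis a 1) (\<lambda>_. axis b 1) p = 0) \<and>
     (\<forall>a b c. ext_deriv2 (fund_form g J) p a b c = 0))"

text \<open>
  Extremality in the sense of Calabi: \<open>J\<nabla>s\<close> is Killing. This form of the condition is local, so it
  applies to the non-compact manifolds considered here, on which the integral of \<open>s\<^sup>2\<close> may diverge.
\<close>

definition extremal_kaehler_on :: "point set \<Rightarrow> matfield \<Rightarrow> matfield \<Rightarrow> bool" where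
  "extremal_kaehler_on M g J \<longleftrightarrow>
     kaehler_on M g J \<and> killing_on M g (\<lambda>p. J p *v gradient g (scal g) p)"


section \<open>The metrics and complex structure under consideration\<close>

definition smooth_on_line :: "real set \<Rightarrow> (real \<Rightarrow> real) \<Rightarrow> bool" where
  "smooth_on_line I f \<longleftrightarrow> (\<forall>n. \<forall>z\<in>I. ((deriv ^^ n) f) differentiable (at z))"

definition biaxial_metric :: "(real \<Rightarrow> real) \<Rightarrow> (real \<Rightarrow> real) \<Rightarrow> matfield" where
  "biaxial_metric F C p = (let z = fst p in \<chi> a b. C z *
     (if a \<noteq> b then 0 else if a = 0 then 1 / (4 * F z) else if a = 1 then F z else 1))"

text \<open>
  \<open>J\<^sup>+ = -2F \<partial>\<^sub>z \<otimes> \<eta>\<^sup>1 + 1/(2F) e\<^sub>1 \<otimes> dz - e\<^sub>2 \<otimes> \<eta>\<^sup>3 + e\<^sub>3 \<otimes> \<eta>\<^sup>2\<close>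
\<close>

definition cplx_struct :: "(real \<Rightarrow> real) \<Rightarrow> matfield" where
  "cplx_struct F p = (let z = fst p in \<chi> a b.
     if (a, b) = (0, 1) then - 2 * F z
     else if (a, b) = (1, 0) then 1 / (2 * F z)
     else if (a, b) = (2, 3) then -1
     else if (a, b) = (3, 2) then 1
     else 0)"

text \<open>The basis \<open>(e\<^sub>0, J e\<^sub>0, e\<^sub>2, J e\<^sub>2)\<close> is positive.\<close>

lemma cplx_struct_oriented:
  assumes "F (fst p) > 0"
  shows "det (\<chi> i. if i = (0::4) then axis 0 1 else if i = 1 then cplx_struct F p *v axis 0 1
                    else if i = 2 then axis 2 1 else cplx_struct F p *v axis 2 1) > 0"
proof -
  define d where "d = (\<lambda>i::4. if i = 1 then 1 / (2 * F (fst p)) else 1)"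
  have four: "(4::4) = 0"
    by simp
  have J0: "cplx_struct F p *v axis 0 1 = axis 1 (1 / (2 * F (fst p)))"
    unfolding matrix_vector_mult_basis column_def
    by (simp add: cplx_struct_def Let_def axis_def vec_eq_iff)
  have J2: "cplx_struct F p *v axis 2 1 = axis 3 1"
    unfolding matrix_vector_mult_basis column_def
    by (simp add: cplx_struct_def Let_def axis_def vec_eq_iff)
  have "\<forall>i. (if i = (0::4) then axis 0 1 else if i = 1 then cplx_struct F p *v axis 0 1
      else if i = 2 then axis 2 1 else cplx_struct F p *v axis 2 1) = axis i (d i)"
    unfolding J0 J2 forall_4 d_def four by simp
  then have e: "(if i = (0::4) then axis 0 1 else if i = 1 then cplx_struct F p *v axis 0 1
      else if i = 2 then axis 2 1 else cplx_struct F p *v axis 2 1) = axis i (d i)" for i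
    by blast
  have "det (\<chi> i. axis i (d i)) = (\<Prod>i\<in>UNIV. d i)"
    by (subst det_diagonal) (simp_all add: axis_def)
  also have "\<dots> = 1 / (2 * F (fst p))"
    by (simp add: d_def)
  finally show ?thesis unfolding e using assms by simp
qed

text \<open>
  \<open>\<L>\<^sup>+ = (-1/2 d/dz + 1)(-d/dz + 1)\<close> and \<open>\<L>\<^sup>- = (1/2 d/dz + 1)(d/dz + 1)\<close>
\<close>

definition first_order_op :: "real \<Rightarrow> (real \<Rightarrow> real) \<Rightarrow> real \<Rightarrow> real" where
  "first_order_op c f = (\<lambda>z. c * deriv f z + f z)"

definition L_plus :: "(real \<Rightarrow> real) \<Rightarrow> real \<Rightarrow> real" where
  "L_plus F = first_order_op (-1/2) (first_order_op (-1) F)"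

definition L_minus :: "(real \<Rightarrow> real) \<Rightarrow> real \<Rightarrow> real" where
  "L_minus F = first_order_op (1/2) (first_order_op 1 F)"

end

theory Submission
  imports Defs
begin

text \<open>
  The metric is diagonal in the frame \<open>e\<^sub>0, e\<^sub>1, e\<^sub>2, e\<^sub>3\<close> and its coefficients depend on \<open>z\<close> only, so in every
  tensor formula \<open>e\<^sub>0\<close> differentiates in \<open>z\<close>, the fields \<open>e\<^sub>1, e\<^sub>2, e\<^sub>3\<close> annihilate all components, and the
  structure constants of the sphere supply the rest. Geometry becomes algebra in the values of \<open>F, F', F''\<close>
  and of \<open>h = C'/(2C)\<close> and its derivative. These finite algebraic identities
  (\<open>curvature_components\<close> and the lemmas around it) are proved for real numbers first and then
  transported to the metric.

  The scalar curvature is read off directly (\<open>scal_eq\<close>). For the Weyl tensor two principles keep the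
  answer small. It is conformally invariant up to the weight \<open>C\<close>, so \<open>h\<close> drops out. And the metric is
  invariant under rotations of the \<open>(e\<^sub>2, e\<^sub>3)\<close>-plane, so each half \<open>W\<^sup>\<plusminus>\<close>, a symmetric trace-free endomorphism of
  \<open>\<Lambda>\<^sup>\<plusminus>\<close>, is one function times a fixed tensor with eigenvalues proportional to \<open>(-2, 1, 1)\<close>. That function
  is \<open>\<L>\<^sup>\<plusminus>F - 1\<close> (\<open>weyl_part_eq\<close>). Consequently \<open>\<delta>W\<^sup>\<plusminus> = 0\<close> is a single linear first-order equation for
  \<open>\<L>\<^sup>\<plusminus>F - 1\<close> (\<open>divergence_weyl_part\<close>), whose integrating factor is \<open>exp (\<plusminus>3z/2) \<surd>C\<close>; on an interval this
  gives the stated constancy (\<open>divergence_free_iff\<close>).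

  The complex structure is integrable and compatible with the metric for all \<open>F\<close> and \<open>C\<close>, and
  \<open>d\<omega> = (C' + C) dz \<and> \<eta>\<^sup>2 \<and> \<eta>\<^sup>3\<close>, so the Kaehler condition is \<open>C = C\<^sub>0 exp (-z)\<close> (\<open>kaehler_iff\<close>). For
  such \<open>C\<close> the condition on \<open>W\<^sup>\<plusminus>\<close> is a second-order equation for \<open>F\<close> with constant coefficients and an
  exponential source, solved by factoring the operator, and \<open>s\<close> is a multiple of
  \<open>exp z (\<L>\<^sup>+F - 1)\<close> (\<open>scalar_kaehler\<close>). When \<open>\<delta>W\<^sup>- = 0\<close>, the derivative of \<open>s\<close> is a constant multiple of \<open>C\<close>; then
  \<open>J\<nabla>s = (2 s'/C) e\<^sub>1\<close> is a constant multiple of the Killing field \<open>e\<^sub>1\<close>, which is extremality.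
\<close>

section \<open>Indices and frame derivatives\<close>

text \<open>
  Tensor identities are checked index by index. The conclusion is a quantified statement, rather than
  \<open>P a\<close>, so that repeated resolution stops once the quantifiers over indices are used up.
\<close>

lemma all_index_I:
  fixes P :: "4 \<Rightarrow> bool"
  assumes "P 0" "P 1" "P 2" "P 3"
  shows "\<forall>a. P a"
proof -
  \<comment> \<open>indices are integers modulo 4, and \<open>forall_4\<close> ranges over 1, 2, 3, 4\<close>
  have four: "(4::4) = 0" by simp
  show ?thesis
    unfolding forall_4 four using assms by blast
qed

lemma sum_index: "sum f (UNIV :: 4 set) = f 0 + f 1 + f 2 + f 3"
proof -
  have four: "(4::4) = 0" by simp
  show ?thesis
    unfolding sum_4 four by (simp only: ac_simps)
qed

lemma index_neq:
  "(0::4) \<noteq> 1" "(0::4) \<noteq> 2" "(0::4) \<noteq> 3" "(1::4) \<noteq> 0" "(1::4) \<noteq> 2" "(1::4) \<noteq> 3"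
  "(2::4) \<noteq> 0" "(2::4) \<noteq> 1" "(2::4) \<noteq> 3" "(3::4) \<noteq> 0" "(3::4) \<noteq> 1" "(3::4) \<noteq> 2"
  by simp_all

text \<open>
  Rewriting with these rules first decides index conditions and deletes vanishing terms, which leaves only
  the few surviving products to field arithmetic.
\<close>

lemmas component_simps =
  index_neq refl if_True if_False simp_thms prod.inject insert_iff empty_iff
  mult_zero_left mult_zero_right add_0_left add_0_right diff_0 diff_0_right minus_zero
  mult_1_left mult_1_right minus_minus div_0 mult_minus_left mult_minus_right

text \<open>
  Everything below is a function of \<open>z\<close> alone, but its closed form is only known for \<open>z \<in> I\<close>. Since
  \<open>I\<close> is open, the flow of \<open>e\<^sub>0\<close> stays inside for small times, and the flows of \<open>e\<^sub>1, e\<^sub>2, e\<^sub>3\<close> do not move \<open>z\<close>.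
\<close>

lemma frame_deriv_of_z:
  fixes \<phi> :: "real \<Rightarrow> real"
  assumes "open I" and p: "fst p \<in> I"
    and f: "\<And>q. fst q \<in> I \<Longrightarrow> f q = \<phi> (fst q)"
    and \<phi>: "(\<phi> has_real_derivative D) (at (fst p))"
  shows "frame_deriv a f p = (if a = 0 then D else 0)"
proof (cases "a = 0")
  case True
  have "((\<lambda>t. \<phi> (t + fst p)) has_real_derivative D) (at 0)"
    using \<phi> DERIV_shift[of \<phi> D 0 "fst p"] by simp
  moreover have "open ((\<lambda>t. t + fst p) -` I)"
    by (intro continuous_open_vimage \<open>open I\<close> continuous_intros)
  ultimately have "((\<lambda>t. f (frame_flow 0 t p)) has_real_derivative D) (at 0)"
    by (rule has_field_derivative_transform_within_open)
       (use p in \<open>auto simp: frame_flow_def f add.commute\<close>)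
  then show ?thesis
    using True unfolding frame_deriv_def by (simp add: DERIV_imp_deriv)
next
  case False
  then have "(\<lambda>t. f (frame_flow a t p)) = (\<lambda>t. \<phi> (fst p))"
    using p by (auto simp: frame_flow_def f)
  then show ?thesis
    using False unfolding frame_deriv_def by simp
qed

lemma frame_deriv_const: "frame_deriv a (\<lambda>_. c) p = 0"
  by (simp add: frame_deriv_def)

lemma fst_I_times_S3: "p \<in> I_times_S3 I \<Longrightarrow> fst p \<in> I"
  by (auto simp: I_times_S3_def)

text \<open>
  The sphere is nonempty, so a condition on \<open>z\<close> loses nothing when it is read on \<open>I \<times> S\<^sup>3\<close>.
\<close>

lemma ball_I_times_S3: "(\<forall>p\<in>I_times_S3 I. P (fst p)) \<longleftrightarrow> (\<forall>z\<in>I. P z)"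
proof -
  have "(z, 1, 0) \<in> I_times_S3 I" if "z \<in> I" for z
    using that by (simp add: I_times_S3_def norm_Pair)
  then show ?thesis
    by (fastforce dest: fst_I_times_S3)
qed

section \<open>Two-forms and the permutation symbol\<close>

text \<open>
  The 2-form \<open>\<eta>\<^sup>i \<and> \<eta>\<^sup>j\<close> evaluated on \<open>(e\<^sub>a, e\<^sub>b)\<close>, with \<open>\<eta>\<^sup>0 = dz\<close>.
\<close>

definition eta2 :: "4 \<Rightarrow> 4 \<Rightarrow> 4 \<Rightarrow> 4 \<Rightarrow> real" where
  "eta2 i j a b = (if a = i \<and> b = j then 1 else if a = j \<and> b = i then -1 else 0)"

text \<open>
  The determinant that occurs in \<open>vol_form\<close>.
\<close>

definition perm_symbol :: "4 \<Rightarrow> 4 \<Rightarrow> 4 \<Rightarrow> 4 \<Rightarrow> real" where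
  "perm_symbol a b c d = det
     ((\<chi> i. axis (if i = 0 then a else if i = 1 then b else if i = 2 then c else d) 1) :: real ^ 4 ^ 4)"

lemma perm_symbol_0123: "perm_symbol 0 1 2 3 = 1"
proof -
  have "\<forall>i j :: 4. axis (if i = 0 then 0 else if i = 1 then 1 else if i = 2 then 2 else 3) 1 $ j
          = (if i = j then 1 else 0 :: real)"
    by (intro all_index_I) (simp_all add: axis_def)
  then have "((\<chi> i. axis (if i = 0 then 0 else if i = 1 then 1 else if i = 2 then 2 else 3) 1) :: real ^ 4 ^ 4)
      = mat 1"
    by (simp add: vec_eq_iff mat_def)
  then show ?thesis by (simp add: perm_symbol_def)
qed

lemma perm_symbol_swap:
  "perm_symbol b a c d = - perm_symbol a b c d"
  "perm_symbol a c b d = - perm_symbol a b c d"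
  "perm_symbol a b d c = - perm_symbol a b c d"
proof -
  have swap: "det ((\<chi> i. A $ Transposition.transpose k l i) :: real ^ 4 ^ 4) = - det A"
    if "k \<noteq> l" for A :: "real ^ 4 ^ 4" and k l
    using that by (simp add: det_permute_rows permutes_swap_id sign_swap_id)
  let ?A = "(\<chi> i. axis (if i = 0 then a else if i = 1 then b else if i = 2 then c else d) 1) :: real ^ 4 ^ 4"
  have "((\<chi> i. axis (if i = 0 then b else if i = 1 then a else if i = 2 then c else d) 1) :: real ^ 4 ^ 4)
      = (\<chi> i. ?A $ Transposition.transpose 0 1 i)"
    by (subst vec_eq_iff, intro all_index_I) (simp_all add: Transposition.transpose_def)
  then show "perm_symbol b a c d = - perm_symbol a b c d"
    unfolding perm_symbol_def by (simp only: swap[OF index_neq(1), of ?A])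
  have "((\<chi> i. axis (if i = 0 then a else if i = 1 then c else if i = 2 then b else d) 1) :: real ^ 4 ^ 4)
      = (\<chi> i. ?A $ Transposition.transpose 1 2 i)"
    by (subst vec_eq_iff, intro all_index_I) (simp_all add: Transposition.transpose_def)
  then show "perm_symbol a c b d = - perm_symbol a b c d"
    unfolding perm_symbol_def by (simp only: swap[OF index_neq(5), of ?A])
  have "((\<chi> i. axis (if i = 0 then a else if i = 1 then b else if i = 2 then d else c) 1) :: real ^ 4 ^ 4)
      = (\<chi> i. ?A $ Transposition.transpose 2 3 i)"
    by (subst vec_eq_iff, intro all_index_I) (simp_all add: Transposition.transpose_def)
  then show "perm_symbol a b d c = - perm_symbol a b c d"
    unfolding perm_symbol_def by (simp only: swap[OF index_neq(9), of ?A])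
qed

text \<open>
  Laplace expansion along the first two rows, that is, the wedge pairing of 2-forms. Both sides are fixed
  by the value at \<open>(0, 1, 2, 3)\<close> and the sign change under swapping neighbours.
\<close>

lemma perm_symbol_eq:
  "perm_symbol a b c d = eta2 0 1 a b * eta2 2 3 c d - eta2 0 2 a b * eta2 1 3 c d
     + eta2 0 3 a b * eta2 1 2 c d + eta2 1 2 a b * eta2 0 3 c d
     - eta2 1 3 a b * eta2 0 2 c d + eta2 2 3 a b * eta2 0 1 c d"
    (is "?P a b c d")
proof -
  have rep: "perm_symbol x x y z = 0" "perm_symbol y x x z = 0" "perm_symbol y z x x = 0" for x y z
    using perm_symbol_swap[of x x y z] perm_symbol_swap[of y x x z] perm_symbol_swap[of y z x x] by simp_all
  have sorted: "perm_symbol 1 0 c d = - perm_symbol 0 1 c d" "perm_symbol 2 0 c d = - perm_symbol 0 2 c d"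
    "perm_symbol 3 0 c d = - perm_symbol 0 3 c d" "perm_symbol 2 1 c d = - perm_symbol 1 2 c d"
    "perm_symbol 3 1 c d = - perm_symbol 1 3 c d" "perm_symbol 3 2 c d = - perm_symbol 2 3 c d"
    "perm_symbol c 1 0 d = - perm_symbol c 0 1 d" "perm_symbol c 2 0 d = - perm_symbol c 0 2 d"
    "perm_symbol c 3 0 d = - perm_symbol c 0 3 d" "perm_symbol c 2 1 d = - perm_symbol c 1 2 d"
    "perm_symbol c 3 1 d = - perm_symbol c 1 3 d" "perm_symbol c 3 2 d = - perm_symbol c 2 3 d"
    "perm_symbol c d 1 0 = - perm_symbol c d 0 1" "perm_symbol c d 2 0 = - perm_symbol c d 0 2"
    "perm_symbol c d 3 0 = - perm_symbol c d 0 3" "perm_symbol c d 2 1 = - perm_symbol c d 1 2"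
    "perm_symbol c d 3 1 = - perm_symbol c d 1 3" "perm_symbol c d 3 2 = - perm_symbol c d 2 3" for c d
    by (rule perm_symbol_swap)+
  have "\<forall>a b c d. ?P a b c d"
    by (intro all_index_I)
       (simp_all only: rep sorted perm_symbol_0123 eta2_def index_neq if_True if_False simp_thms
         minus_zero mult_zero_left mult_zero_right mult_1 mult_1_right add_0_left add_0_right diff_0
         diff_0_right minus_minus mult_minus_left mult_minus_right)
  then show ?thesis by blast
qed

section \<open>Component identities for the curvature of biaxial metrics\<close>

text \<open>
  The diagonal of the metric for \<open>C = 1\<close>, as a function of the value \<open>f\<close> of \<open>F\<close>.
\<close>

definition base_weight :: "real \<Rightarrow> 4 \<Rightarrow> real" where
  "base_weight f a = (if a = 0 then 1 / (4 * f) else if a = 1 then f else 1)"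

text \<open>
  In this and the following tables the real arguments \<open>f, f1, f2\<close> stand for the values of \<open>F, F', F''\<close> at
  a point, and \<open>h, h1\<close> for those of \<open>C'/(2C)\<close> and its derivative. The conformal factor enters the
  connection through \<open>h\<close> only.
\<close>

definition christoffel :: "real \<Rightarrow> real \<Rightarrow> real \<Rightarrow> 4 \<Rightarrow> 4 \<Rightarrow> 4 \<Rightarrow> real" where
  "christoffel f f1 h a b c =
     (if (a, b, c) = (0, 0, 0) then h - f1 / (2 * f)
      else if (a, b, c) \<in> {(0, 1, 1), (1, 0, 1)} then h + f1 / (2 * f)
      else if (a, b, c) \<in> {(0, 2, 2), (2, 0, 2), (0, 3, 3), (3, 0, 3)} then h
      else if (a, b, c) = (1, 1, 0) then - 4 * f\<^sup>2 * h - 2 * f * f1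
      else if (a, b, c) \<in> {(2, 2, 0), (3, 3, 0)} then - 4 * f * h
      else if (a, b, c) = (1, 2, 3) then 2 - f
      else if (a, b, c) = (1, 3, 2) then f - 2
      else if (a, b, c) = (2, 3, 1) then 1
      else if (a, b, c) = (3, 2, 1) then - 1
      else if (a, b, c) = (3, 1, 2) then f
      else if (a, b, c) = (2, 1, 3) then - f
      else 0)"

text \<open>
  The derivative of \<open>christoffel\<close> in \<open>z\<close>, with \<open>f' = f1\<close>, \<open>f1' = f2\<close> and \<open>h' = h1\<close>.
\<close>

definition christoffel' :: "real \<Rightarrow> real \<Rightarrow> real \<Rightarrow> real \<Rightarrow> real \<Rightarrow> 4 \<Rightarrow> 4 \<Rightarrow> 4 \<Rightarrow> real" where
  "christoffel' f f1 f2 h h1 a b c =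
     (if (a, b, c) = (0, 0, 0) then h1 - f2 / (2 * f) + f1\<^sup>2 / (2 * f\<^sup>2)
      else if (a, b, c) \<in> {(0, 1, 1), (1, 0, 1)} then h1 + f2 / (2 * f) - f1\<^sup>2 / (2 * f\<^sup>2)
      else if (a, b, c) \<in> {(0, 2, 2), (2, 0, 2), (0, 3, 3), (3, 0, 3)} then h1
      else if (a, b, c) = (1, 1, 0) then - 8 * f * f1 * h - 4 * f\<^sup>2 * h1 - 2 * f1\<^sup>2 - 2 * f * f2
      else if (a, b, c) \<in> {(2, 2, 0), (3, 3, 0)} then - 4 * f1 * h - 4 * f * h1
      else if (a, b, c) \<in> {(1, 3, 2), (3, 1, 2)} then f1
      else if (a, b, c) \<in> {(1, 2, 3), (2, 1, 3)} then - f1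
      else 0)"

text \<open>
  The lowered curvature tensor divided by \<open>C\<close>, as a symmetric form on 2-forms. Rotations of the
  \<open>(e\<^sub>2, e\<^sub>3)\<close>-plane are symmetries, which is why the 2-forms containing just one of \<open>\<eta>\<^sup>2, \<eta>\<^sup>3\<close> occur in pairs
  with equal coefficients. The mixed products, those with coefficient proportional to \<open>f1\<close>, make \<open>W\<^sup>+\<close> and
  \<open>W\<^sup>-\<close> different.
\<close>

definition riemann_coeff :: "real \<Rightarrow> real \<Rightarrow> real \<Rightarrow> real \<Rightarrow> real \<Rightarrow> 4 \<Rightarrow> 4 \<Rightarrow> 4 \<Rightarrow> 4 \<Rightarrow> real" where
  "riemann_coeff f f1 f2 h h1 a b c d =
     - (f2 / 2 + f * h1 + f1 * h) * (eta2 0 1 a b * eta2 0 1 c d)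
     - (h1 + f1 * h / (2 * f)) * (eta2 0 2 a b * eta2 0 2 c d + eta2 0 3 a b * eta2 0 3 c d)
     + (f\<^sup>2 - 2 * f * f1 * h - 4 * f\<^sup>2 * h\<^sup>2) * (eta2 1 2 a b * eta2 1 2 c d + eta2 1 3 a b * eta2 1 3 c d)
     + (4 - 3 * f - 4 * f * h\<^sup>2) * (eta2 2 3 a b * eta2 2 3 c d)
     + f1 * (eta2 0 1 a b * eta2 2 3 c d + eta2 2 3 a b * eta2 0 1 c d)
     + f1 / 2 * (eta2 0 2 a b * eta2 1 3 c d + eta2 1 3 a b * eta2 0 2 c d
               - eta2 0 3 a b * eta2 1 2 c d - eta2 1 2 a b * eta2 0 3 c d)"

text \<open>
  Diagonal entries of the Ricci tensor in the frame; the off-diagonal ones vanish.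
\<close>

definition ricci_coeff :: "real \<Rightarrow> real \<Rightarrow> real \<Rightarrow> real \<Rightarrow> real \<Rightarrow> 4 \<Rightarrow> real" where
  "ricci_coeff f f1 f2 h h1 b =
     (if b = 0 then - f2 / (2 * f) - 3 * h1 - 2 * f1 * h / f
      else if b = 1 then 2 * f\<^sup>2 - 2 * f * f2 - 4 * f\<^sup>2 * h1 - 8 * f * f1 * h - 8 * f\<^sup>2 * h\<^sup>2
      else 4 - 2 * f - 4 * f * h1 - 4 * f1 * h - 8 * f * h\<^sup>2)"

text \<open>
  For \<open>\<epsilon> = 1\<close> a basis of the self-dual 2-forms, for \<open>\<epsilon> = -1\<close> of the anti-self-dual ones. The basis is
  orthogonal; the first element is proportional to \<open>\<omega>\<^sup>\<plusminus>\<close>, and the other two have \<open>f\<close> times its squared length.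
\<close>

definition sd_form :: "real \<Rightarrow> real \<Rightarrow> 4 \<Rightarrow> 4 \<Rightarrow> 4 \<Rightarrow> real" where
  "sd_form \<epsilon> f k a b =
     (if k = 1 then eta2 0 1 a b + 2 * \<epsilon> * eta2 2 3 a b
      else if k = 2 then eta2 0 2 a b - 2 * \<epsilon> * f * eta2 1 3 a b
      else if k = 3 then eta2 0 3 a b + 2 * \<epsilon> * f * eta2 1 2 a b
      else 0)"

text \<open>
  A symmetric trace-free endomorphism of \<open>\<Lambda>\<^sup>\<plusminus>\<close> commuting with rotations of the \<open>(e\<^sub>2, e\<^sub>3)\<close>-plane has eigenvalues
  proportional to \<open>(-2, 1, 1)\<close>, so up to a factor this is the only form that either half of the Weyl tensor
  can take.
\<close>

definition half_weyl :: "real \<Rightarrow> real \<Rightarrow> 4 \<Rightarrow> 4 \<Rightarrow> 4 \<Rightarrow> 4 \<Rightarrow> real" where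
  "half_weyl \<epsilon> f a b c d =
     (sd_form \<epsilon> f 2 a b * sd_form \<epsilon> f 2 c d + sd_form \<epsilon> f 3 a b * sd_form \<epsilon> f 3 c d) / (12 * f)
     - sd_form \<epsilon> f 1 a b * sd_form \<epsilon> f 1 c d / 6"

text \<open>
  The derivative of \<open>half_weyl \<epsilon> f\<close> in \<open>f\<close> when \<open>\<epsilon>\<^sup>2 = 1\<close>; see \<open>half_weyl_deriv\<close>.
\<close>

definition half_weyl' :: "real \<Rightarrow> real \<Rightarrow> 4 \<Rightarrow> 4 \<Rightarrow> 4 \<Rightarrow> 4 \<Rightarrow> real" where
  "half_weyl' \<epsilon> f a b c d =
     - (eta2 0 2 a b * eta2 0 2 c d + eta2 0 3 a b * eta2 0 3 c d) / (12 * f\<^sup>2)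
     + (eta2 1 3 a b * eta2 1 3 c d + eta2 1 2 a b * eta2 1 2 c d) / 3"

text \<open>
  The conditional terms are the derivatives of the Christoffel symbols along \<open>e\<^sub>a\<close> and \<open>e\<^sub>b\<close>, nonzero only
  along \<open>e\<^sub>0\<close>. Multiplying by \<open>base_weight\<close> lowers the last index, which brings out the symmetry in pairs
  of indices.
\<close>

lemma curvature_components:
  fixes f f1 f2 h h1 :: real
  assumes "f \<noteq> 0"
  defines "\<Gamma> \<equiv> christoffel f f1 h" and "\<Gamma>' \<equiv> christoffel' f f1 f2 h h1"
  shows "((if a = 0 then \<Gamma>' b c d else 0) - (if b = 0 then \<Gamma>' a c d else 0)
      + (\<Sum>e\<in>UNIV. \<Gamma> b c e * \<Gamma> a e d - \<Gamma> a c e * \<Gamma> b e d - struct_const a b e * \<Gamma> e c d))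
      * base_weight f d
    = riemann_coeff f f1 f2 h h1 a b d c"
    (is "?P a b c d")
proof -
  have "\<forall>a b c d. ?P a b c d"
    unfolding \<Gamma>_def \<Gamma>'_def
    by (intro all_index_I,
        simp_all only: sum_index base_weight_def eta2_def struct_const_def christoffel_def christoffel'_def riemann_coeff_def component_simps)
       (use \<open>f \<noteq> 0\<close> in \<open>simp_all add: field_simps power2_eq_square\<close>)
  then show ?thesis by blast
qed

lemma ricci_components:
  fixes f f1 f2 h h1 :: real
  assumes "f \<noteq> 0"
  shows "(\<Sum>a\<in>UNIV. riemann_coeff f f1 f2 h h1 a b a d / base_weight f a)
    = (if b = d then ricci_coeff f f1 f2 h h1 b else 0)"
    (is "?P b d")
proof -
  have "\<forall>b d. ?P b d"
    by (intro all_index_I,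
        simp_all only: sum_index eta2_def ricci_coeff_def base_weight_def riemann_coeff_def component_simps)
       (use \<open>f \<noteq> 0\<close> in \<open>simp_all add: field_simps power2_eq_square\<close>)
  then show ?thesis by blast
qed

text \<open>
  The left-hand side is the Weyl tensor divided by \<open>C\<close>. All terms in \<open>h\<close> and \<open>h1\<close> cancel, which is the
  conformal invariance of the Weyl tensor, and the two coefficients that remain are \<open>\<L>\<^sup>\<plusminus>F - 1\<close>.
\<close>

lemma weyl_components:
  fixes f f1 f2 h h1 :: real
  assumes "f \<noteq> 0"
  defines "R \<equiv> riemann_coeff f f1 f2 h h1" and "r \<equiv> ricci_coeff f f1 f2 h h1"
    and "s \<equiv> - (4 * f2 + 2 * f - 8 + 24 * (f1 * h + f * h1 + f * h\<^sup>2))"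
    and "m \<equiv> \<lambda>a b. if a = b then base_weight f a else 0"
  shows "R a b c d
     - (1/2) * (m a c * (if b = d then r b else 0) - m a d * (if b = c then r b else 0)
              - m b c * (if a = d then r a else 0) + m b d * (if a = c then r a else 0))
     + (s / 6) * (m a c * m b d - m a d * m b c)
    = (f2 / 2 - 3 / 2 * f1 + f - 1) * half_weyl 1 f a b c d
      + (f2 / 2 + 3 / 2 * f1 + f - 1) * half_weyl (- 1) f a b c d"
    (is "?P a b c d")
proof -
  have "\<forall>a b c d. ?P a b c d"
    unfolding R_def r_def m_def
    by (intro all_index_I,
        simp_all only: eta2_def ricci_coeff_def base_weight_def riemann_coeff_def half_weyl_def sd_form_def component_simps)
       (use \<open>f \<noteq> 0\<close> in \<open>simp_all add: s_def field_simps power2_eq_square\<close>)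
  then show ?thesis by blast
qed

text \<open>
  The Hodge star acts on the first pair of indices, so the identity reduces to the (anti-)self-duality
  of the three basis forms.
\<close>

lemma hodge_components:
  fixes f :: real
  assumes "f \<noteq> 0" "\<epsilon> = 1 \<or> \<epsilon> = - 1"
  shows "(\<Sum>i\<in>UNIV. \<Sum>j\<in>UNIV. perm_symbol a b i j / (4 * base_weight f i * base_weight f j) * half_weyl \<epsilon> f i j c d)
    = \<epsilon> * half_weyl \<epsilon> f a b c d"
proof -
  have "\<forall>k a b. (\<Sum>i\<in>UNIV. \<Sum>j\<in>UNIV. perm_symbol a b i j / (4 * base_weight f i * base_weight f j) * sd_form \<epsilon> f k i j)
    = \<epsilon> * sd_form \<epsilon> f k a b"
    unfolding perm_symbol_eq
    by (intro all_index_I,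
        simp_all only: sum_index eta2_def base_weight_def sd_form_def component_simps)
       (use assms in \<open>auto simp: field_simps power2_eq_square\<close>)
  then have star: "(\<Sum>i\<in>UNIV. \<Sum>j\<in>UNIV. perm_symbol a b i j / (4 * base_weight f i * base_weight f j)
      * sd_form \<epsilon> f k i j) = \<epsilon> * sd_form \<epsilon> f k a b" for k by blast
  have linear: "(\<Sum>i\<in>UNIV. \<Sum>j\<in>UNIV. P i j * half_weyl \<epsilon> f i j c d)
      = (\<Sum>i\<in>UNIV. \<Sum>j\<in>UNIV. P i j * sd_form \<epsilon> f 2 i j) * (sd_form \<epsilon> f 2 c d / (12 * f))
        + (\<Sum>i\<in>UNIV. \<Sum>j\<in>UNIV. P i j * sd_form \<epsilon> f 3 i j) * (sd_form \<epsilon> f 3 c d / (12 * f))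
        - (\<Sum>i\<in>UNIV. \<Sum>j\<in>UNIV. P i j * sd_form \<epsilon> f 1 i j) * (sd_form \<epsilon> f 1 c d / 6)"
    for P :: "4 \<Rightarrow> 4 \<Rightarrow> real"
    unfolding sum_distrib_right sum.distrib[symmetric] sum_subtractf[symmetric]
    by (intro sum.cong refl) (simp add: half_weyl_def add_divide_distrib ring_distribs)
  show ?thesis
    unfolding linear star by (simp add: half_weyl_def add_divide_distrib ring_distribs)
qed

text \<open>
  The heart of the computation: for a tensor \<open>y \<cdot> half_weyl\<close> with \<open>y\<close> depending on \<open>z\<close> and derivative
  \<open>y1\<close>, the 64 components of the divergence are multiples of one first-order expression in \<open>y\<close>. In the last two
  slots only the basis forms \<open>sd_form\<close> can appear, since covariant derivatives preserve \<open>\<Lambda>\<^sup>\<plusminus>\<close>.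
\<close>

lemma divergence_components:
  fixes f f1 h y y1 :: real
  assumes "f \<noteq> 0" "\<epsilon> = 1 \<or> \<epsilon> = - 1"
  defines "\<Gamma> \<equiv> christoffel f f1 h" and "T \<equiv> half_weyl \<epsilon> f"
  shows "(\<Sum>e\<in>UNIV. ((if e = 0 then y1 * T e b c d + y * f1 * half_weyl' \<epsilon> f e b c d else 0)
     - (\<Sum>i\<in>UNIV. \<Gamma> e e i * (y * T i b c d) + \<Gamma> e b i * (y * T e i c d)
           + \<Gamma> e c i * (y * T e b i d) + \<Gamma> e d i * (y * T e b c i))) / base_weight f e)
    = (y1 + (3 / 2 * \<epsilon> - h) * y) * (if b = 1 then - 2 / 3 * f * sd_form \<epsilon> f 1 c d else sd_form \<epsilon> f b c d / 3)"
    (is "?P b c d")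
proof -
  have "\<forall>b c d. ?P b c d"
    unfolding \<Gamma>_def T_def
    by (intro all_index_I,
        simp_all only: sum_index eta2_def base_weight_def christoffel_def half_weyl_def half_weyl'_def sd_form_def component_simps)
       (use assms in \<open>auto simp: field_simps power2_eq_square\<close>)
  then show ?thesis by blast
qed

section \<open>Component identities for the complex structure\<close>

definition cplx_coeff :: "real \<Rightarrow> 4 \<Rightarrow> 4 \<Rightarrow> real" where
  "cplx_coeff f a b =
     (if a = 0 \<and> b = 1 then - 2 * f
      else if a = 1 \<and> b = 0 then 1 / (2 * f)
      else if a = 2 \<and> b = 3 then - 1
      else if a = 3 \<and> b = 2 then 1
      else 0)"

text \<open>
  The derivative of \<open>cplx_coeff\<close> in \<open>z\<close>, with \<open>f' = f1\<close>.
\<close>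

definition cplx_coeff' :: "real \<Rightarrow> real \<Rightarrow> 4 \<Rightarrow> 4 \<Rightarrow> real" where
  "cplx_coeff' f f1 a b =
     (if a = 0 \<and> b = 1 then - 2 * f1
      else if a = 1 \<and> b = 0 then - f1 / (2 * f\<^sup>2)
      else 0)"

lemma cplx_struct_eq: "cplx_struct F p $ a $ b = cplx_coeff (F (fst p)) a b"
  by (simp add: cplx_struct_def cplx_coeff_def Let_def)

lemma matrix_vector_axis_nth: "(M *v axis b (1::real)) $ a = M $ a $ b"
  for M :: "real ^ 4 ^ 4"
  by (simp add: matrix_vector_mult_basis column_def)

lemma matrix_vector_nth: "(M *v x) $ a = (\<Sum>b\<in>UNIV. M $ a $ b * x $ b)"
  by (simp add: matrix_vector_mult_def)

text \<open>
  The Lie bracket of fields whose components \<open>x, y\<close> depend on \<open>z\<close> only, with derivatives \<open>x', y'\<close>.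
\<close>

definition frame_bracket ::
    "(4 \<Rightarrow> real) \<Rightarrow> (4 \<Rightarrow> real) \<Rightarrow> (4 \<Rightarrow> real) \<Rightarrow> (4 \<Rightarrow> real) \<Rightarrow> 4 \<Rightarrow> real" where
  "frame_bracket x x' y y' c =
     x 0 * y' c - y 0 * x' c + (\<Sum>a\<in>UNIV. \<Sum>b\<in>UNIV. x a * y b * struct_const a b c)"

lemma lie_bracket_eq:
  assumes "\<And>c. X p $ c = x c" "\<And>a c. frame_deriv a (\<lambda>q. X q $ c) p = (if a = 0 then x' c else 0)"
    and "\<And>c. Y p $ c = y c" "\<And>a c. frame_deriv a (\<lambda>q. Y q $ c) p = (if a = 0 then y' c else 0)"
  shows "lie_bracket X Y p $ c = frame_bracket x x' y y' c"
  by (simp add: lie_bracket_def frame_bracket_def assms sum_index[of "\<lambda>a. _ a - _ a"] index_neq)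

text \<open>
  The complex structure is integrable for every profile \<open>F\<close>: the derivatives of \<open>F\<close> in the four brackets
  cancel.
\<close>

lemma nijenhuis_components:
  fixes f f1 :: real
  assumes "f \<noteq> 0"
  defines "J \<equiv> cplx_coeff f" and "J' \<equiv> cplx_coeff' f f1"
  shows "frame_bracket (\<lambda>i. J i a) (\<lambda>i. J' i a) (\<lambda>i. J i b) (\<lambda>i. J' i b) d
      - (\<Sum>c\<in>UNIV. J d c * frame_bracket (\<lambda>i. J i a) (\<lambda>i. J' i a) (\<lambda>i. if i = b then 1 else 0) (\<lambda>_. 0) c)
      - (\<Sum>c\<in>UNIV. J d c * frame_bracket (\<lambda>i. if i = a then 1 else 0) (\<lambda>_. 0) (\<lambda>i. J i b) (\<lambda>i. J' i b) c)
      - frame_bracket (\<lambda>i. if i = a then 1 else 0) (\<lambda>_. 0) (\<lambda>i. if i = b then 1 else 0) (\<lambda>_. 0) d = 0"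
    (is "?P a b d")
proof -
  have "\<forall>a b d. ?P a b d"
    unfolding J_def J'_def
    by (intro all_index_I,
        simp_all only: frame_bracket_def sum_index cplx_coeff_def cplx_coeff'_def struct_const_def component_simps)
       (use \<open>f \<noteq> 0\<close> in \<open>simp_all add: field_simps power2_eq_square\<close>)
  then show ?thesis by blast
qed

text \<open>
  The fundamental form is \<open>\<omega> = c (dz \<and> \<eta>\<^sup>1 / 2 + \<eta>\<^sup>2 \<and> \<eta>\<^sup>3)\<close>. Since \<open>d\<eta>\<^sup>1 = -2 \<eta>\<^sup>2 \<and> \<eta>\<^sup>3\<close> and
  \<open>\<eta>\<^sup>2 \<and> \<eta>\<^sup>3\<close> is closed, \<open>d\<omega> = (c' + c) dz \<and> \<eta>\<^sup>2 \<and> \<eta>\<^sup>3\<close>; the permutation symbol with first index 1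
  expresses this 3-form up to sign.
\<close>

lemma ext_deriv_components:
  fixes c c1 :: real
  defines "w \<equiv> \<lambda>a b. eta2 0 1 a b / 2 + eta2 2 3 a b"
  shows "(if a = 0 then c1 * w b d else 0) + (if b = 0 then c1 * w d a else 0) + (if d = 0 then c1 * w a b else 0)
     - (\<Sum>f\<in>UNIV. struct_const a b f * (c * w f d) + struct_const b d f * (c * w f a)
                 + struct_const d a f * (c * w f b))
    = - (c1 + c) * perm_symbol 1 a b d"
    (is "?P a b d")
proof -
  have "\<forall>a b d. ?P a b d"
    unfolding w_def perm_symbol_eq
    by (intro all_index_I,
        simp_all only: sum_index eta2_def struct_const_def component_simps)
  then show ?thesis by blast
qed

section \<open>Differential equations on an interval\<close>

lemma deriv_eqI_on_open:
  fixes f :: "real \<Rightarrow> real"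
  assumes "open S" "z \<in> S" "\<And>x. x \<in> S \<Longrightarrow> f x = \<phi> x" "(\<phi> has_real_derivative D) (at z)"
  shows "deriv f z = D"
proof -
  have "(f has_real_derivative D) (at z)"
    by (rule has_field_derivative_transform_within_open[OF assms(4,1,2)]) (simp add: assms(3))
  then show ?thesis by (rule DERIV_imp_deriv)
qed

text \<open>
  Connectedness of the interval is what turns the local condition into a global constant.
\<close>

lemma constant_on_iff_deriv_zero:
  fixes f :: "real \<Rightarrow> real"
  assumes "open S" "is_interval S" and f: "\<And>z. z \<in> S \<Longrightarrow> (f has_real_derivative f' z) (at z)"
  shows "f constant_on S \<longleftrightarrow> (\<forall>z\<in>S. f' z = 0)"
proof
  assume "f constant_on S"
  then obtain c where c: "\<And>z. z \<in> S \<Longrightarrow> f z = c"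
    by (auto simp: constant_on_def)
  show "\<forall>z\<in>S. f' z = 0"
  proof
    fix z assume z: "z \<in> S"
    have "deriv f z = 0"
      by (rule deriv_eqI_on_open[OF \<open>open S\<close> z c]) simp_all
    then show "f' z = 0"
      using DERIV_imp_deriv[OF f[OF z]] by simp
  qed
next
  assume "\<forall>z\<in>S. f' z = 0"
  then have "\<exists>c. \<forall>z\<in>S. f z = c"
    using f \<open>is_interval S\<close>
    by (intro has_field_derivative_zero_constant) (auto simp: is_interval_convex_1 intro: DERIV_subset)
  then show "f constant_on S"
    by (simp add: constant_on_def)
qed

text \<open>
  The equation factors as \<open>(D - a)(D - b) G = 0\<close>. Hence \<open>(D - a) G\<close> is a multiple of \<open>exp (b z)\<close> and
  \<open>(D - b) G\<close> a multiple of \<open>exp (a z)\<close>, and subtracting the two gives \<open>(b - a) G\<close> without further integration.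
\<close>

lemma linear_ode_two_exponentials:
  fixes G :: "real \<Rightarrow> real"
  assumes "open S" "is_interval S"
    and G: "\<And>z. z \<in> S \<Longrightarrow> (G has_real_derivative G1 z) (at z)"
    and G1: "\<And>z. z \<in> S \<Longrightarrow> (G1 has_real_derivative G2 z) (at z)"
    and ode: "\<And>z. z \<in> S \<Longrightarrow> G2 z - (a + b) * G1 z + a * b * G z = 0"
    and "a \<noteq> b"
  shows "\<exists>A B. \<forall>z\<in>S. G z = A * exp (a * z) + B * exp (b * z)"
proof -
  have const: "\<exists>k. \<forall>z\<in>S. (G1 z - c * G z) * exp (- d * z) = k"
    if cd: "c + d = a + b" "c * d = a * b" for c d
  proof -
    have deriv: "((\<lambda>z. (G1 z - c * G z) * exp (- d * z)) has_real_derivative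
        (G2 z - (c + d) * G1 z + c * d * G z) * exp (- d * z)) (at z)" if "z \<in> S" for z
      by (rule derivative_eq_intros G[OF that] G1[OF that] refl | simp add: algebra_simps)+
    have "((\<lambda>z. (G1 z - c * G z) * exp (- d * z)) has_real_derivative 0) (at z)" if "z \<in> S" for z
      using deriv[OF that] unfolding cd ode[OF that] mult_zero_left .
    then show ?thesis
      using constant_on_iff_deriv_zero[OF assms(1,2), of "\<lambda>z. (G1 z - c * G z) * exp (- d * z)" "\<lambda>_. 0"]
      by (simp add: constant_on_def)
  qed
  obtain k l where k: "\<And>z. z \<in> S \<Longrightarrow> (G1 z - a * G z) * exp (- b * z) = k"
    and l: "\<And>z. z \<in> S \<Longrightarrow> (G1 z - b * G z) * exp (- a * z) = l"
    using const[of a b] const[of b a] by (auto simp: ac_simps)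
  have "G z = (- l / (b - a)) * exp (a * z) + (k / (b - a)) * exp (b * z)" if "z \<in> S" for z
  proof -
    have "G1 z - a * G z = k * exp (b * z)" "G1 z - b * G z = l * exp (a * z)"
      using k[OF that] l[OF that] by (auto simp: exp_minus field_simps)
    then have "(b - a) * G z = k * exp (b * z) - l * exp (a * z)"
      by (simp add: algebra_simps)
    then have "G z = (k * exp (b * z) - l * exp (a * z)) / (b - a)"
      using \<open>a \<noteq> b\<close> by (simp add: eq_divide_eq mult.commute)
    then show ?thesis
      by (simp add: diff_divide_distrib)
  qed
  then show ?thesis by blast
qed

section \<open>The Levi-Civita connection\<close>

locale biaxial =
  fixes I :: "real set" and F C :: "real \<Rightarrow> real"
  assumes open_I: "open I"
    and smooth_F: "smooth_on_line I F" and smooth_C: "smooth_on_line I C"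
    and F_pos: "z \<in> I \<Longrightarrow> F z > 0" and C_pos: "z \<in> I \<Longrightarrow> C z > 0"
begin

abbreviation g :: matfield where "g \<equiv> biaxial_metric F C"
abbreviation F1 :: "real \<Rightarrow> real" where "F1 \<equiv> deriv F"
abbreviation F2 :: "real \<Rightarrow> real" where "F2 \<equiv> deriv F1"
abbreviation F3 :: "real \<Rightarrow> real" where "F3 \<equiv> deriv F2"

text \<open>
  Half the logarithmic derivative of the conformal factor \<open>C\<close>, so that \<open>C' = 2 h C\<close> and
  \<open>(\<surd>C)' = h \<surd>C\<close>.
\<close>

definition h :: "real \<Rightarrow> real" where "h z = deriv C z / (2 * C z)"

abbreviation h1 :: "real \<Rightarrow> real" where "h1 \<equiv> deriv h"

lemma F_nz: "z \<in> I \<Longrightarrow> F z \<noteq> 0" and C_nz: "z \<in> I \<Longrightarrow> C z \<noteq> 0"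
  using F_pos C_pos by force+

lemma iterated_deriv:
  assumes "smooth_on_line I f" "z \<in> I"
  shows "((deriv ^^ n) f has_real_derivative (deriv ^^ Suc n) f z) (at z)"
  using assms by (simp add: smooth_on_line_def DERIV_deriv_iff_real_differentiable)

lemma F_derivs:
  assumes "z \<in> I"
  shows "(F has_real_derivative F1 z) (at z)" "(F1 has_real_derivative F2 z) (at z)"
    "(F2 has_real_derivative F3 z) (at z)"
  using iterated_deriv[OF smooth_F assms, of 0] iterated_deriv[OF smooth_F assms, of 1]
    iterated_deriv[OF smooth_F assms, of 2] by (simp_all add: numeral_2_eq_2)

lemma C_deriv:
  assumes "z \<in> I"
  shows "(C has_real_derivative 2 * h z * C z) (at z)"
  using iterated_deriv[OF smooth_C assms, of 0] C_nz[OF assms] by (simp add: h_def)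

lemma h_deriv:
  assumes "z \<in> I"
  shows "(h has_real_derivative h1 z) (at z)"
proof -
  have "((\<lambda>z. deriv C z / (2 * C z)) has_real_derivative
      (deriv (deriv C) z * (2 * C z) - deriv C z * (2 * deriv C z)) / (2 * C z)\<^sup>2) (at z)"
    using iterated_deriv[OF smooth_C assms, of 0] iterated_deriv[OF smooth_C assms, of 1] C_nz[OF assms]
    by (auto intro!: derivative_eq_intros simp: power2_eq_square)
  then have "(h has_real_derivative
      (deriv (deriv C) z * (2 * C z) - deriv C z * (2 * deriv C z)) / (2 * C z)\<^sup>2) (at z)"
    by (simp add: h_def[abs_def])
  then show ?thesis by (simp add: DERIV_imp_deriv)
qed

definition weight :: "real \<Rightarrow> 4 \<Rightarrow> real" where
  "weight z a = C z * base_weight (F z) a"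

lemma weight_nz: "z \<in> I \<Longrightarrow> weight z a \<noteq> 0"
  by (simp add: weight_def base_weight_def C_nz F_nz)

lemma g_eq: "g p $ a $ b = (if a = b then weight (fst p) a else 0)"
  by (simp add: biaxial_metric_def weight_def base_weight_def Let_def)

lemma g_inv_eq:
  assumes "fst p \<in> I"
  shows "matrix_inv (g p) $ a $ b = (if a = b then 1 / weight (fst p) a else 0)"
proof -
  let ?B = "(\<chi> a b. if a = b then 1 / weight (fst p) a else 0) :: real ^ 4 ^ 4"
  have B: "g p ** ?B = mat 1" "?B ** g p = mat 1"
    unfolding vec_eq_iff
    by (intro all_index_I; simp add: matrix_matrix_mult_def sum_index g_eq mat_def weight_nz[OF assms])+
  have "g p ** matrix_inv (g p) = mat 1 \<and> matrix_inv (g p) ** g p = mat 1"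
    unfolding matrix_inv_def by (rule someI[of _ ?B]) (simp only: B simp_thms)
  then have "matrix_inv (g p) = matrix_inv (g p) ** (g p ** ?B)" "matrix_inv (g p) ** g p = mat 1"
    by (simp_all only: B matrix_mul_rid)
  then have "matrix_inv (g p) = ?B"
    by (simp only: matrix_mul_assoc matrix_mul_lid)
  then show ?thesis by simp
qed

lemma frame_deriv_eq:
  assumes "fst p \<in> I" "\<And>q. fst q \<in> I \<Longrightarrow> f q = \<phi> (fst q)"
    and "(\<phi> has_real_derivative D) (at (fst p))"
  shows "frame_deriv a f p = (if a = 0 then D else 0)"
  using frame_deriv_of_z[OF open_I] assms by blast

definition weight_log_deriv :: "real \<Rightarrow> 4 \<Rightarrow> real" where
  "weight_log_deriv z a =
     2 * h z + (if a = 0 then - F1 z / F z else if a = 1 then F1 z / F z else 0)"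

lemma weight_deriv:
  assumes "z \<in> I"
  shows "((\<lambda>z. weight z a) has_real_derivative weight z a * weight_log_deriv z a) (at z)"
proof -
  have "((\<lambda>z. C z * (1 / (4 * F z))) has_real_derivative
      C z * (1 / (4 * F z)) * (2 * h z - F1 z / F z)) (at z)"
    "((\<lambda>z. C z * F z) has_real_derivative C z * F z * (2 * h z + F1 z / F z)) (at z)"
    by (rule derivative_eq_intros F_derivs[OF assms] C_deriv[OF assms] refl
        | simp add: F_nz[OF assms] field_simps power2_eq_square)+
  moreover have "((\<lambda>z. C z * 1) has_real_derivative C z * 1 * (2 * h z)) (at z)"
    using C_deriv[OF assms] by (simp add: mult.commute)
  ultimately show ?thesis
    unfolding weight_def base_weight_def weight_log_deriv_def by simp
qed

lemma frame_deriv_g: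
  assumes p: "fst p \<in> I"
  shows "frame_deriv c (\<lambda>q. g q $ a $ b) p =
    (if c = 0 then if a = b then weight (fst p) a * weight_log_deriv (fst p) a else 0 else 0)"
proof (rule frame_deriv_eq[OF p])
  show "g q $ a $ b = (if a = b then weight (fst q) a else 0)" for q
    by (rule g_eq)
  show "((\<lambda>z. if a = b then weight z a else 0) has_real_derivative
      (if a = b then weight (fst p) a * weight_log_deriv (fst p) a else 0)) (at (fst p))"
    using weight_deriv[OF p] by simp
qed

lemma conn_eq:
  assumes p: "fst p \<in> I"
  shows "conn g p a b c = christoffel (F (fst p)) (F1 (fst p)) (h (fst p)) a b c"
    (is "?P a b c")
proof -
  have "\<forall>a b c. ?P a b c"
    unfolding conn_def koszul_def frame_deriv_g[OF p]
    by (intro all_index_I,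
        simp_all only: sum_index g_eq g_inv_eq[OF p] struct_const_def christoffel_def component_simps)
       (use F_nz[OF p] C_nz[OF p] in \<open>simp_all add: weight_def base_weight_def weight_log_deriv_def field_simps power2_eq_square\<close>)
  then show ?thesis by blast
qed

lemma frame_deriv_conn:
  assumes p: "fst p \<in> I"
  shows "frame_deriv e (\<lambda>q. conn g q a b c) p =
    (if e = 0 then christoffel' (F (fst p)) (F1 (fst p)) (F2 (fst p)) (h (fst p)) (h1 (fst p)) a b c
     else 0)"
proof (rule frame_deriv_eq[OF p])
  show "conn g q a b c = christoffel (F (fst q)) (F1 (fst q)) (h (fst q)) a b c" if "fst q \<in> I" for q
    by (rule conn_eq[OF that])
  have "\<forall>a b c. ((\<lambda>z. christoffel (F z) (F1 z) (h z) a b c) has_real_derivative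
      christoffel' (F (fst p)) (F1 (fst p)) (F2 (fst p)) (h (fst p)) (h1 (fst p)) a b c) (at (fst p))"
    by (intro all_index_I,
        simp_all only: christoffel_def christoffel'_def component_simps)
       (auto intro!: derivative_eq_intros F_derivs[OF p] h_deriv[OF p]
          simp: F_nz[OF p] field_simps power2_eq_square)
  then show "((\<lambda>z. christoffel (F z) (F1 z) (h z) a b c) has_real_derivative
      christoffel' (F (fst p)) (F1 (fst p)) (F2 (fst p)) (h (fst p)) (h1 (fst p)) a b c) (at (fst p))"
    by blast
qed

section \<open>Curvature and its self-dual parts\<close>

lemma curv_eq:
  assumes p: "fst p \<in> I"
  shows "curv g p a b c d =
    riemann_coeff (F (fst p)) (F1 (fst p)) (F2 (fst p)) (h (fst p)) (h1 (fst p)) a b d c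
      / base_weight (F (fst p)) d"
proof -
  have "base_weight (F (fst p)) d \<noteq> 0"
    using F_nz[OF p] by (simp add: base_weight_def)
  moreover have "curv g p a b c d * base_weight (F (fst p)) d =
    riemann_coeff (F (fst p)) (F1 (fst p)) (F2 (fst p)) (h (fst p)) (h1 (fst p)) a b d c"
    unfolding curv_def frame_deriv_conn[OF p] conn_eq[OF p]
    by (rule curvature_components[OF F_nz[OF p]])
  ultimately show ?thesis
    by (simp add: field_simps)
qed

lemma riem_eq:
  assumes p: "fst p \<in> I"
  shows "riem g p a b c d =
    C (fst p) * riemann_coeff (F (fst p)) (F1 (fst p)) (F2 (fst p)) (h (fst p)) (h1 (fst p)) a b c d"
proof -
  have "base_weight (F (fst p)) c \<noteq> 0"
    using F_nz[OF p] by (simp add: base_weight_def)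
  then have "riem g p a b c d = (\<Sum>e\<in>UNIV. if c = e then C (fst p)
      * riemann_coeff (F (fst p)) (F1 (fst p)) (F2 (fst p)) (h (fst p)) (h1 (fst p)) a b e d else 0)"
    unfolding riem_def g_eq curv_eq[OF p] weight_def by (intro sum.cong) auto
  then show ?thesis by simp
qed

lemma ric_eq:
  assumes p: "fst p \<in> I"
  shows "ric g p b d =
    (if b = d then ricci_coeff (F (fst p)) (F1 (fst p)) (F2 (fst p)) (h (fst p)) (h1 (fst p)) b else 0)"
  unfolding ric_def curv_eq[OF p] by (rule ricci_components[OF F_nz[OF p]])

definition scalar :: "real \<Rightarrow> real" where
  "scalar z = - (4 * F2 z + 2 * F z - 8 + 24 * (F1 z * h z + F z * h1 z + F z * (h z)\<^sup>2)) / C z"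

lemma scal_eq:
  assumes p: "fst p \<in> I"
  shows "scal g p = scalar (fst p)"
  using F_nz[OF p] C_nz[OF p]
  by (simp add: scal_def ric_eq[OF p] g_inv_eq[OF p] sum_index weight_def base_weight_def ricci_coeff_def scalar_def
      field_simps power2_eq_square)

text \<open>
  This is \<open>\<L>\<^sup>\<plusminus>F - 1\<close> for \<open>\<epsilon> = \<plusminus>1\<close>, see \<open>L_ops_eq\<close>.
\<close>

definition L_defect :: "real \<Rightarrow> real \<Rightarrow> real" where
  "L_defect \<epsilon> z = F2 z / 2 - 3 / 2 * \<epsilon> * F1 z + F z - 1"

text \<open>
  Lowering indices with \<open>C\<close> times the base metric multiplies the Weyl tensor by \<open>C\<close>.
\<close>

lemma weyl_eq:
  assumes p: "fst p \<in> I"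
  shows "weyl g p a b c d = C (fst p) * (L_defect 1 (fst p) * half_weyl 1 (F (fst p)) a b c d
      + L_defect (- 1) (fst p) * half_weyl (- 1) (F (fst p)) a b c d)"
proof -
  have w: "g p $ a $ b = C (fst p) * (if a = b then base_weight (F (fst p)) a else 0)" for a b
    by (simp add: g_eq weight_def)
  \<comment> \<open>how the three summands of the Weyl tensor scale with the conformal factor \<open>c\<close>\<close>
  have scaling: "c * r - (1/2) * (c * x1 * r1 - c * x2 * r2 - c * x3 * r3 + c * x4 * r4)
        + (s / c / 6) * (c * x1 * (c * x4) - c * x2 * (c * x3))
      = c * (r - (1/2) * (x1 * r1 - x2 * r2 - x3 * r3 + x4 * r4) + (s / 6) * (x1 * x4 - x2 * x3))"
    if "c \<noteq> 0" for c r r1 r2 r3 r4 s x1 x2 x3 x4 :: real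
    using that by (simp add: field_simps)
  show ?thesis
    unfolding weyl_def riem_eq[OF p] ric_eq[OF p] scal_eq[OF p] w scalar_def scaling[OF C_nz[OF p]]
      L_defect_def mult_1_right mult_minus1_right
    by (subst weyl_components[OF F_nz[OF p]]) (simp add: algebra_simps)
qed

text \<open>
  The determinant of the metric is \<open>C\<^sup>4/4\<close>: the factors \<open>1/(4F)\<close> and \<open>F\<close> cancel up to the constant.
\<close>

lemma vol_form_eq:
  assumes p: "fst p \<in> I"
  shows "vol_form g p a b c d = (C (fst p))\<^sup>2 / 2 * perm_symbol a b c d"
proof -
  have "det (g p) = (\<Prod>i\<in>UNIV. weight (fst p) i)"
    by (subst det_diagonal) (simp_all add: g_eq)
  also have "\<dots> = ((C (fst p))\<^sup>2 / 2)\<^sup>2"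
  proof -
    have four: "(4::4) = 0" by simp
    show ?thesis
      using F_nz[OF p] unfolding UNIV_4 four
      by (simp add: weight_def base_weight_def power2_eq_square)
  qed
  finally show ?thesis
    unfolding vol_form_def perm_symbol_def by simp
qed

lemma hodge_weyl_eq:
  assumes p: "fst p \<in> I"
  shows "hodge g (weyl g) p a b c d = C (fst p) * (L_defect 1 (fst p) * half_weyl 1 (F (fst p)) a b c d
      - L_defect (- 1) (fst p) * half_weyl (- 1) (F (fst p)) a b c d)"
proof -
  let ?P = "\<lambda>i j. perm_symbol a b i j / (4 * base_weight (F (fst p)) i * base_weight (F (fst p)) j)"
  have star: "(\<Sum>i\<in>UNIV. \<Sum>j\<in>UNIV. ?P i j * half_weyl \<epsilon> (F (fst p)) i j c d) = \<epsilon> * half_weyl \<epsilon> (F (fst p)) a b c d"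
    if "\<epsilon> = 1 \<or> \<epsilon> = - 1" for \<epsilon>
    using hodge_components[OF F_nz[OF p] that] .
  have "hodge g (weyl g) p a b c d =
    (1/2) * (\<Sum>i\<in>UNIV. \<Sum>j\<in>UNIV. \<Sum>e\<in>UNIV. \<Sum>f\<in>UNIV. if j = f then if i = e then
        (C (fst p))\<^sup>2 / 2 * perm_symbol a b i j / weight (fst p) i / weight (fst p) j * weyl g p e f c d else 0 else 0)"
    unfolding hodge_def vol_form_eq[OF p] g_inv_eq[OF p]
    by (intro arg_cong[where f = "(*) (1/2)"] sum.cong refl) auto
  also have "\<dots> = (1/2) * (\<Sum>i\<in>UNIV. \<Sum>j\<in>UNIV.
        (C (fst p))\<^sup>2 / 2 * perm_symbol a b i j / weight (fst p) i / weight (fst p) j * weyl g p i j c d)"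
    by simp
  also have "\<dots> = C (fst p) * L_defect 1 (fst p) * (\<Sum>i\<in>UNIV. \<Sum>j\<in>UNIV. ?P i j * half_weyl 1 (F (fst p)) i j c d)
     + C (fst p) * L_defect (- 1) (fst p) * (\<Sum>i\<in>UNIV. \<Sum>j\<in>UNIV. ?P i j * half_weyl (- 1) (F (fst p)) i j c d)"
    unfolding sum_distrib_left sum.distrib[symmetric] weyl_eq[OF p] weight_def
    using C_nz[OF p]
    by (intro sum.cong refl) (simp add: power2_eq_square divide_simps, simp add: algebra_simps)
  finally show ?thesis
    unfolding star[OF disjI1[OF refl]] star[OF disjI2[OF refl]] by (simp add: algebra_simps)
qed

definition weyl_part :: "real \<Rightarrow> tensor4" where
  "weyl_part \<epsilon> p a b c d = (1/2) * (weyl g p a b c d + \<epsilon> * hodge g (weyl g) p a b c d)"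

lemma weyl_parts: "weyl_plus g = weyl_part 1" "weyl_minus g = weyl_part (- 1)"
  by (simp_all add: fun_eq_iff weyl_plus_def weyl_minus_def weyl_part_def)

lemma weyl_part_eq:
  assumes p: "fst p \<in> I" and \<epsilon>: "\<epsilon> = 1 \<or> \<epsilon> = - 1"
  shows "weyl_part \<epsilon> p a b c d = C (fst p) * L_defect \<epsilon> (fst p) * half_weyl \<epsilon> (F (fst p)) a b c d"
  using \<epsilon> by (auto simp: weyl_part_def weyl_eq[OF p] hodge_weyl_eq[OF p] algebra_simps)

lemma L_defect_deriv:
  assumes "z \<in> I"
  shows "(L_defect \<epsilon> has_real_derivative F3 z / 2 - 3 / 2 * \<epsilon> * F2 z + F1 z) (at z)"
  unfolding L_defect_def[abs_def]
  by (auto intro!: derivative_eq_intros F_derivs[OF assms])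

lemma half_weyl_deriv:
  assumes z: "z \<in> I" and \<epsilon>: "\<epsilon> = 1 \<or> \<epsilon> = - 1"
  shows "((\<lambda>z. half_weyl \<epsilon> (F z) a b c d) has_real_derivative F1 z * half_weyl' \<epsilon> (F z) a b c d) (at z)"
proof -
  \<comment> \<open>for \<open>\<epsilon>\<^sup>2 = 1\<close> the mixed products do not depend on \<open>F\<close>\<close>
  have expand: "half_weyl \<epsilon> (F z) a b c d =
      (eta2 0 2 a b * eta2 0 2 c d + eta2 0 3 a b * eta2 0 3 c d) / (12 * F z)
      + F z * (eta2 1 3 a b * eta2 1 3 c d + eta2 1 2 a b * eta2 1 2 c d) / 3
      + \<epsilon> / 6 * (eta2 0 3 a b * eta2 1 2 c d + eta2 1 2 a b * eta2 0 3 c d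
               - eta2 0 2 a b * eta2 1 3 c d - eta2 1 3 a b * eta2 0 2 c d)
      - sd_form \<epsilon> 1 1 a b * sd_form \<epsilon> 1 1 c d / 6" if "z \<in> I" for z
    using \<epsilon> F_nz[OF that] by (auto simp: half_weyl_def sd_form_def field_simps)
  have "((\<lambda>z. (eta2 0 2 a b * eta2 0 2 c d + eta2 0 3 a b * eta2 0 3 c d) / (12 * F z)
      + F z * (eta2 1 3 a b * eta2 1 3 c d + eta2 1 2 a b * eta2 1 2 c d) / 3
      + \<epsilon> / 6 * (eta2 0 3 a b * eta2 1 2 c d + eta2 1 2 a b * eta2 0 3 c d
               - eta2 0 2 a b * eta2 1 3 c d - eta2 1 3 a b * eta2 0 2 c d)
      - sd_form \<epsilon> 1 1 a b * sd_form \<epsilon> 1 1 c d / 6) has_real_derivative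
      F1 z * half_weyl' \<epsilon> (F z) a b c d) (at z)"
    by (rule derivative_eq_intros F_derivs[OF z] refl
        | simp add: F_nz[OF z] half_weyl'_def field_simps power2_eq_square)+
  then show ?thesis
    by (rule has_field_derivative_transform_within_open[OF _ open_I z]) (simp only: expand)
qed

text \<open>
  With \<open>y = C (\<L>\<^sup>\<plusminus>F - 1)\<close>, so \<open>y' = C (\<L>\<^sup>\<plusminus>F - 1)' + 2 h y\<close>, the first-order expression of
  \<open>divergence_components\<close> becomes \<open>C\<close> times the one written here, and the inverse metric removes \<open>C\<close>.
\<close>

lemma divergence_weyl_part:
  assumes p: "fst p \<in> I" and \<epsilon>: "\<epsilon> = 1 \<or> \<epsilon> = - 1"
  shows "divergence g (weyl_part \<epsilon>) p b c d =
    (F3 (fst p) / 2 - 3 / 2 * \<epsilon> * F2 (fst p) + F1 (fst p) + (3 / 2 * \<epsilon> + h (fst p)) * L_defect \<epsilon> (fst p))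
    * (if b = 1 then - 2 / 3 * F (fst p) * sd_form \<epsilon> (F (fst p)) 1 c d
       else sd_form \<epsilon> (F (fst p)) b c d / 3)"
proof -
  define z where "z = fst p"
  have z: "z \<in> I" using p by (simp add: z_def)
  define y where "y = C z * L_defect \<epsilon> z"
  define y1 where "y1 = C z * (F3 z / 2 - 3 / 2 * \<epsilon> * F2 z + F1 z + 2 * h z * L_defect \<epsilon> z)"
  have D: "frame_deriv e (\<lambda>q. weyl_part \<epsilon> q a b c d) p = (if e = 0 then
      y1 * half_weyl \<epsilon> (F z) a b c d + y * F1 z * half_weyl' \<epsilon> (F z) a b c d else 0)" for e a b c d
  proof (rule frame_deriv_eq[OF p])
    show "weyl_part \<epsilon> q a b c d = C (fst q) * L_defect \<epsilon> (fst q) * half_weyl \<epsilon> (F (fst q)) a b c d"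
      if "fst q \<in> I" for q
      by (rule weyl_part_eq[OF that \<epsilon>])
    show "((\<lambda>z. C z * L_defect \<epsilon> z * half_weyl \<epsilon> (F z) a b c d) has_real_derivative
      y1 * half_weyl \<epsilon> (F z) a b c d + y * F1 z * half_weyl' \<epsilon> (F z) a b c d) (at (fst p))"
      unfolding z_def[symmetric] y_def y1_def
      by (rule derivative_eq_intros C_deriv[OF z] L_defect_deriv[OF z] half_weyl_deriv[OF z \<epsilon>] refl
        | simp add: field_simps)+
  qed
  have "divergence g (weyl_part \<epsilon>) p b c d = (\<Sum>e\<in>UNIV. \<Sum>a\<in>UNIV. if e = a then
      cov_deriv g (weyl_part \<epsilon>) p e e b c d / base_weight (F z) e / C z else 0)"
    unfolding divergence_def g_inv_eq[OF p] weight_def z_def by (intro sum.cong refl) auto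
  also have "\<dots> = (\<Sum>e\<in>UNIV. cov_deriv g (weyl_part \<epsilon>) p e e b c d / base_weight (F z) e) / C z"
    by (simp add: sum_divide_distrib)
  also have "\<dots> = (y1 + (3 / 2 * \<epsilon> - h z) * y)
      * (if b = 1 then - 2 / 3 * F z * sd_form \<epsilon> (F z) 1 c d else sd_form \<epsilon> (F z) b c d / 3) / C z"
    unfolding cov_deriv_def D conn_eq[OF p] weyl_part_eq[OF p \<epsilon>] z_def[symmetric] y_def[symmetric]
    by (subst divergence_components[OF F_nz[OF z] \<epsilon>]) (rule refl)
  also have "(y1 + (3 / 2 * \<epsilon> - h z) * y) = C z *
     (F3 z / 2 - 3 / 2 * \<epsilon> * F2 z + F1 z + (3 / 2 * \<epsilon> + h z) * L_defect \<epsilon> z)"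
    by (simp add: y_def y1_def algebra_simps)
  finally show ?thesis
    using C_nz[OF z] by (simp add: z_def[symmetric])
qed

section \<open>Constant scalar curvature and divergence-free Weyl curvature\<close>

text \<open>
  The expression on the right is \<open>C\<^bsup>3/2\<^esup> (s\<^sub>0 - s)\<close>, because \<open>(F (\<surd>C)')' = \<surd>C (F' h + F h' + F h\<^sup>2)\<close>.
\<close>

lemma scal_const_iff:
  "(\<forall>p\<in>I_times_S3 I. scal g p = s\<^sub>0) \<longleftrightarrow>
     (\<forall>z\<in>I. 0 = s\<^sub>0 * C z powr (3/2) + 4 * C z powr (1/2) * (F2 z + (1/2) * F z - 2)
               + 24 * deriv (\<lambda>y. F y * deriv (\<lambda>x. C x powr (1/2)) y) z)"
proof -
  have root: "((\<lambda>x. C x powr (1/2)) has_real_derivative C z powr (1/2) * h z) (at z)" if z: "z \<in> I" for z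
  proof -
    have "C z powr (1/2 - 1) = C z powr (1/2) / C z"
      using C_pos[OF z] by (subst powr_diff) simp
    then show ?thesis
      using C_pos[OF z]
      by (auto intro!: derivative_eq_intros C_deriv[OF z] simp: field_simps)
  qed
  have "deriv (\<lambda>y. F y * deriv (\<lambda>x. C x powr (1/2)) y) z
      = C z powr (1/2) * (F1 z * h z + F z * h1 z + F z * (h z)\<^sup>2)" if z: "z \<in> I" for z
  proof (rule deriv_eqI_on_open[OF open_I z])
    show "F y * deriv (\<lambda>x. C x powr (1/2)) y = F y * (C y powr (1/2) * h y)" if "y \<in> I" for y
      using DERIV_imp_deriv[OF root[OF that]] by simp
    show "((\<lambda>y. F y * (C y powr (1/2) * h y)) has_real_derivative
        C z powr (1/2) * (F1 z * h z + F z * h1 z + F z * (h z)\<^sup>2)) (at z)"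
      by (rule derivative_eq_intros root[OF z] F_derivs[OF z] h_deriv[OF z] refl
          | simp add: algebra_simps power2_eq_square)+
  qed
  moreover have "C z powr (3/2) = C z powr (1/2) * C z" if "z \<in> I" for z
    using C_pos[OF that] powr_add[of "C z" "1/2" 1] by simp
  moreover have "scalar z = s\<^sub>0 \<longleftrightarrow> 0 = s\<^sub>0 * (C z powr (1/2) * C z)
      + 4 * C z powr (1/2) * (F2 z + (1/2) * F z - 2)
      + 24 * (C z powr (1/2) * (F1 z * h z + F z * h1 z + F z * (h z)\<^sup>2))" if z: "z \<in> I" for z
  proof -
    have "s\<^sub>0 * (C z powr (1/2) * C z) + 4 * C z powr (1/2) * (F2 z + (1/2) * F z - 2)
        + 24 * (C z powr (1/2) * (F1 z * h z + F z * h1 z + F z * (h z)\<^sup>2))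
        = (C z powr (1/2) * C z) * (s\<^sub>0 - scalar z)"
      using C_nz[OF z] by (simp add: scalar_def field_simps)
    then show ?thesis
      using C_nz[OF z] by auto
  qed
  ultimately have "(\<forall>z\<in>I. scalar z = s\<^sub>0) \<longleftrightarrow>
     (\<forall>z\<in>I. 0 = s\<^sub>0 * C z powr (3/2) + 4 * C z powr (1/2) * (F2 z + (1/2) * F z - 2)
               + 24 * deriv (\<lambda>y. F y * deriv (\<lambda>x. C x powr (1/2)) y) z)"
    by simp
  moreover have "(\<forall>p\<in>I_times_S3 I. scal g p = s\<^sub>0) \<longleftrightarrow> (\<forall>z\<in>I. scalar z = s\<^sub>0)"
    using ball_I_times_S3[of I "\<lambda>z. scalar z = s\<^sub>0"] by (simp add: scal_eq fst_I_times_S3)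
  ultimately show ?thesis by simp
qed

text \<open>
  The component \<open>(2, 0, 2)\<close> of the divergence is a third of the expression, so its vanishing already
  forces that of the whole tensor.
\<close>

lemma divergence_free_iff_ode:
  assumes \<epsilon>: "\<epsilon> = 1 \<or> \<epsilon> = - 1"
  shows "divergence_free_on (I_times_S3 I) g (weyl_part \<epsilon>) \<longleftrightarrow>
    (\<forall>z\<in>I. F3 z / 2 - 3 / 2 * \<epsilon> * F2 z + F1 z + (3 / 2 * \<epsilon> + h z) * L_defect \<epsilon> z = 0)"
    (is "_ \<longleftrightarrow> (\<forall>z\<in>I. ?E z = 0)")
proof -
  have "(\<forall>b c d. divergence g (weyl_part \<epsilon>) p b c d = 0) \<longleftrightarrow> ?E (fst p) = 0" if p: "fst p \<in> I" for p
  proof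
    assume "\<forall>b c d. divergence g (weyl_part \<epsilon>) p b c d = 0"
    then have "divergence g (weyl_part \<epsilon>) p 2 0 2 = 0" by blast
    then show "?E (fst p) = 0"
      by (simp add: divergence_weyl_part[OF p \<epsilon>] sd_form_def eta2_def)
  next
    assume "?E (fst p) = 0"
    then show "\<forall>b c d. divergence g (weyl_part \<epsilon>) p b c d = 0"
      unfolding divergence_weyl_part[OF p \<epsilon>] by (simp only: mult_zero_left) blast
  qed
  then show ?thesis
    unfolding divergence_free_on_def
    using ball_I_times_S3[of I "\<lambda>z. ?E z = 0"] by (simp only: fst_I_times_S3 cong: ball_cong)
qed

text \<open>
  The first-order equation says that \<open>exp (\<plusminus>3z/2) \<surd>C\<close> is an integrating factor for \<open>\<L>\<^sup>\<plusminus>F - 1\<close>.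
\<close>

lemma divergence_free_iff:
  assumes \<epsilon>: "\<epsilon> = 1 \<or> \<epsilon> = - 1" and "is_interval I"
  shows "divergence_free_on (I_times_S3 I) g (weyl_part \<epsilon>) \<longleftrightarrow>
    (\<lambda>z. exp (3 / 2 * \<epsilon> * z) * L_defect \<epsilon> z * sqrt (C z)) constant_on I"
proof -
  let ?E = "\<lambda>z. F3 z / 2 - 3 / 2 * \<epsilon> * F2 z + F1 z + (3 / 2 * \<epsilon> + h z) * L_defect \<epsilon> z"
  have root: "((\<lambda>z. sqrt (C z)) has_real_derivative sqrt (C z) * h z) (at z)" if z: "z \<in> I" for z
  proof -
    have "sqrt (C z) \<noteq> 0" "sqrt (C z) * sqrt (C z) = C z"
      using C_pos[OF z] by simp_all
    then show ?thesis
      using C_pos[OF z] by (auto intro!: derivative_eq_intros C_deriv[OF z] simp: field_simps)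
  qed
  have "((\<lambda>z. exp (3 / 2 * \<epsilon> * z) * L_defect \<epsilon> z * sqrt (C z)) has_real_derivative
      exp (3 / 2 * \<epsilon> * z) * sqrt (C z) * ?E z) (at z)" if z: "z \<in> I" for z
    by (rule derivative_eq_intros root[OF z] L_defect_deriv[OF z] refl | simp add: algebra_simps)+
  then have "(\<lambda>z. exp (3 / 2 * \<epsilon> * z) * L_defect \<epsilon> z * sqrt (C z)) constant_on I
      \<longleftrightarrow> (\<forall>z\<in>I. exp (3 / 2 * \<epsilon> * z) * sqrt (C z) * ?E z = 0)"
    by (rule constant_on_iff_deriv_zero[OF open_I \<open>is_interval I\<close>])
  also have "\<dots> \<longleftrightarrow> (\<forall>z\<in>I. ?E z = 0)"
    using C_nz by auto
  finally show ?thesis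
    using divergence_free_iff_ode[OF \<epsilon>] by simp
qed

lemma first_order_op_twice:
  assumes "z \<in> I"
  shows "first_order_op c (first_order_op d F) z = c * d * F2 z + (c + d) * F1 z + F z"
proof -
  have "((\<lambda>z. d * F1 z + F z) has_real_derivative d * F2 z + F1 z) (at z)"
    by (auto intro!: derivative_eq_intros F_derivs[OF assms])
  then show ?thesis
    by (simp add: first_order_op_def DERIV_imp_deriv algebra_simps)
qed

lemma L_ops_eq:
  assumes "z \<in> I"
  shows "L_plus F z - 1 = L_defect 1 z" "L_minus F z - 1 = L_defect (- 1) z"
  by (simp_all add: L_plus_def L_minus_def first_order_op_twice[OF assms] L_defect_def)

section \<open>The Kaehler condition\<close>

abbreviation J :: matfield where "J \<equiv> cplx_struct F"

lemma frame_deriv_J: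
  assumes p: "fst p \<in> I"
  shows "frame_deriv e (\<lambda>q. J q $ a $ b) p =
    (if e = 0 then cplx_coeff' (F (fst p)) (F1 (fst p)) a b else 0)"
proof (rule frame_deriv_eq[OF p])
  show "J q $ a $ b = cplx_coeff (F (fst q)) a b" for q
    by (rule cplx_struct_eq)
  have "((\<lambda>z. 1 / (2 * F z)) has_real_derivative - F1 (fst p) / (2 * (F (fst p))\<^sup>2)) (at (fst p))"
    "((\<lambda>z. - 2 * F z) has_real_derivative - 2 * F1 (fst p)) (at (fst p))"
    by (rule derivative_eq_intros F_derivs[OF p] refl
        | simp add: F_nz[OF p] field_simps power2_eq_square)+
  then have "\<forall>a b. ((\<lambda>z. cplx_coeff (F z) a b) has_real_derivative
      cplx_coeff' (F (fst p)) (F1 (fst p)) a b) (at (fst p))"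
    by (intro all_index_I) (simp_all add: cplx_coeff_def cplx_coeff'_def)
  then show "((\<lambda>z. cplx_coeff (F z) a b) has_real_derivative
      cplx_coeff' (F (fst p)) (F1 (fst p)) a b) (at (fst p))"
    by blast
qed

lemma J_squared:
  assumes p: "fst p \<in> I"
  shows "J p ** J p = - mat 1"
  unfolding vec_eq_iff
  by (intro all_index_I; simp add: matrix_matrix_mult_def sum_index cplx_struct_eq cplx_coeff_def mat_def F_nz[OF p])

lemma J_isometry:
  assumes p: "fst p \<in> I"
  shows "transpose (J p) ** g p ** J p = g p"
  unfolding vec_eq_iff
  by (intro all_index_I; simp add: matrix_matrix_mult_def transpose_def sum_index cplx_struct_eq cplx_coeff_def
      g_eq weight_def base_weight_def F_nz[OF p])

lemma nijenhuis_zero: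
  assumes p: "fst p \<in> I"
  shows "nijenhuis J (\<lambda>_. axis a 1) (\<lambda>_. axis b 1) p = 0"
proof -
  have Je: "(J p *v axis b 1) $ c = cplx_coeff (F (fst p)) c b"
    "frame_deriv e (\<lambda>q. (J q *v axis b 1) $ c) p =
       (if e = 0 then cplx_coeff' (F (fst p)) (F1 (fst p)) c b else 0)" for b c e
    unfolding matrix_vector_axis_nth frame_deriv_J[OF p] by (rule cplx_struct_eq refl)+
  have e: "axis b (1::real) $ c = (if c = b then 1 else 0)"
    "frame_deriv e (\<lambda>_. axis b 1 $ c) p = (if e = 0 then 0 else 0)" for b c e :: 4
    by (simp_all add: axis_def frame_deriv_const)
  have "nijenhuis J (\<lambda>_. axis a 1) (\<lambda>_. axis b 1) p $ d = 0" for d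
    unfolding nijenhuis_def vector_minus_component matrix_vector_nth[of "J p" _ d]
      lie_bracket_eq[where X = "\<lambda>q. J q *v axis a 1" and Y = "\<lambda>q. J q *v axis b 1", OF Je Je]
      lie_bracket_eq[where X = "\<lambda>q. J q *v axis a 1" and Y = "\<lambda>_. axis b 1", OF Je e]
      lie_bracket_eq[where X = "\<lambda>_. axis a 1" and Y = "\<lambda>q. J q *v axis b 1", OF e Je]
      lie_bracket_eq[where X = "\<lambda>_. axis a 1" and Y = "\<lambda>_. axis b 1", OF e e] cplx_struct_eq
    by (rule nijenhuis_components[OF F_nz[OF p]])
  then show ?thesis by (simp add: vec_eq_iff)
qed

lemma fund_form_eq:
  assumes p: "fst p \<in> I"
  shows "fund_form g J p $ a $ b = C (fst p) * (eta2 0 1 a b / 2 + eta2 2 3 a b)"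
    (is "?P a b")
proof -
  have "\<forall>a b. ?P a b"
    by (intro all_index_I; simp add: fund_form_def sum_index cplx_struct_eq cplx_coeff_def g_eq weight_def base_weight_def eta2_def F_nz[OF p])
  then show ?thesis by blast
qed

lemma ext_deriv_fund_form:
  assumes p: "fst p \<in> I"
  shows "ext_deriv2 (fund_form g J) p a b d = - (C (fst p) * (2 * h (fst p) + 1)) * perm_symbol 1 a b d"
proof -
  have "frame_deriv e (\<lambda>q. fund_form g J q $ a $ b) p =
      (if e = 0 then (2 * h (fst p) * C (fst p)) * (eta2 0 1 a b / 2 + eta2 2 3 a b) else 0)" for e a b
  proof (rule frame_deriv_eq[OF p])
    show "fund_form g J q $ a $ b = C (fst q) * (eta2 0 1 a b / 2 + eta2 2 3 a b)" if "fst q \<in> I" for q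
      by (rule fund_form_eq[OF that])
    show "((\<lambda>z. C z * (eta2 0 1 a b / 2 + eta2 2 3 a b)) has_real_derivative
        (2 * h (fst p) * C (fst p)) * (eta2 0 1 a b / 2 + eta2 2 3 a b)) (at (fst p))"
      by (rule DERIV_cmult_right[OF C_deriv[OF p]])
  qed
  then show ?thesis
    unfolding ext_deriv2_def fund_form_eq[OF p]
    using ext_deriv_components[of a "2 * h (fst p) * C (fst p)" b d "C (fst p)"]
    by (simp add: algebra_simps)
qed

text \<open>
  Integrability and compatibility always hold, so only \<open>d\<omega> = 0\<close> remains, which reads \<open>C' + C = 0\<close>.
\<close>

lemma kaehler_iff:
  assumes "is_interval I" "I \<noteq> {}"
  shows "kaehler_on (I_times_S3 I) g J \<longleftrightarrow> (\<exists>C\<^sub>0>0. \<forall>z\<in>I. C z = C\<^sub>0 * exp (- z))"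
proof -
  have "(\<forall>a b d. ext_deriv2 (fund_form g J) p a b d = 0) \<longleftrightarrow> 2 * h (fst p) + 1 = 0" if p: "fst p \<in> I" for p
  proof
    assume "\<forall>a b d. ext_deriv2 (fund_form g J) p a b d = 0"
    then have "ext_deriv2 (fund_form g J) p 0 2 3 = 0" by blast
    then show "2 * h (fst p) + 1 = 0"
      using C_nz[OF p] by (simp add: ext_deriv_fund_form[OF p] perm_symbol_eq eta2_def)
  qed (simp add: ext_deriv_fund_form[OF p])
  then have "kaehler_on (I_times_S3 I) g J \<longleftrightarrow> (\<forall>p\<in>I_times_S3 I. 2 * h (fst p) + 1 = 0)"
    unfolding kaehler_on_def
    by (intro ball_cong refl) (simp add: J_squared J_isometry nijenhuis_zero fst_I_times_S3)
  also have "\<dots> \<longleftrightarrow> (\<forall>z\<in>I. 2 * h z + 1 = 0)"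
    by (rule ball_I_times_S3)
  \<comment> \<open>\<open>C exp z (2 h + 1)\<close> is the derivative of \<open>C exp z\<close>\<close>
  also have "\<dots> \<longleftrightarrow> (\<forall>z\<in>I. C z * exp z * (2 * h z + 1) = 0)"
    using C_nz by auto
  also have "\<dots> \<longleftrightarrow> (\<lambda>z. C z * exp z) constant_on I"
  proof (rule constant_on_iff_deriv_zero[OF open_I \<open>is_interval I\<close>, symmetric])
    show "((\<lambda>z. C z * exp z) has_real_derivative C z * exp z * (2 * h z + 1)) (at z)" if "z \<in> I" for z
      by (rule derivative_eq_intros C_deriv[OF that] refl | simp add: algebra_simps)+
  qed
  also have "\<dots> \<longleftrightarrow> (\<exists>C\<^sub>0. \<forall>z\<in>I. C z = C\<^sub>0 * exp (- z))"
    unfolding constant_on_def by (simp add: exp_minus field_simps)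
  also have "\<dots> \<longleftrightarrow> (\<exists>C\<^sub>0>0. \<forall>z\<in>I. C z = C\<^sub>0 * exp (- z))"
  proof -
    obtain z\<^sub>0 where "z\<^sub>0 \<in> I" using \<open>I \<noteq> {}\<close> by blast
    have "C\<^sub>0 > 0" if "\<forall>z\<in>I. C z = C\<^sub>0 * exp (- z)" for C\<^sub>0
      using C_pos[OF \<open>z\<^sub>0 \<in> I\<close>] that \<open>z\<^sub>0 \<in> I\<close> by (simp add: zero_less_mult_iff)
    then show ?thesis by blast
  qed
  finally show ?thesis .
qed

section \<open>Kaehler metrics with divergence-free half Weyl tensor\<close>

lemma kaehler_profile_derivs:
  assumes C: "\<forall>z\<in>I. C z = C\<^sub>0 * exp (- z)" and "C\<^sub>0 > 0" and z: "z \<in> I"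
  shows "h z = - 1 / 2" "h1 z = 0"
proof -
  have h: "h z = - 1 / 2" if "z \<in> I" for z
  proof -
    have "deriv C z = - C\<^sub>0 * exp (- z)"
      using C by (intro deriv_eqI_on_open[OF open_I that, of C "\<lambda>z. C\<^sub>0 * exp (- z)"])
        (auto intro!: derivative_eq_intros)
    then show ?thesis
      using C that \<open>C\<^sub>0 > 0\<close> by (simp add: h_def)
  qed
  then show "h z = - 1 / 2" using z .
  show "h1 z = 0"
    by (rule deriv_eqI_on_open[OF open_I z h]) simp_all
qed

text \<open>
  With \<open>h = -1/2\<close> the second-order part of the scalar curvature is the same combination
  \<open>F'' - 3 F' + 2 F - 2\<close> that makes up \<open>\<L>\<^sup>+F - 1\<close>. On a Kaehler surface \<open>W\<^sup>+\<close> is always determined by \<open>s\<close>.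
\<close>

lemma scalar_kaehler:
  assumes C: "\<forall>z\<in>I. C z = C\<^sub>0 * exp (- z)" and "C\<^sub>0 > 0" and z: "z \<in> I"
  shows "scalar z = - 8 * L_defect 1 z * exp z / C\<^sub>0"
proof -
  have "1 / C z = exp z / C\<^sub>0"
    using C z by (simp add: exp_minus divide_inverse)
  moreover have "scalar z = - 8 * L_defect 1 z * (1 / C z)"
    unfolding scalar_def kaehler_profile_derivs[OF assms] L_defect_def
    by (simp add: algebra_simps power2_eq_square diff_divide_distrib add_divide_distrib)
  ultimately show ?thesis by simp
qed

text \<open>
  On \<open>exp (k z)\<close> the operators \<open>\<L>\<^sup>\<plusminus>\<close> act by \<open>(1 \<mp> k/2)(1 \<mp> k)\<close>: \<open>\<L>\<^sup>+\<close> kills \<open>k = 1, 2\<close> and \<open>\<L>\<^sup>-\<close> kills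
  \<open>k = -1, -2\<close>.
\<close>

lemma L_defect_exponential_sum:
  assumes F: "\<forall>z\<in>I. F z = 1 + k\<^sub>1 * exp (- 2 * z) + k\<^sub>2 * exp (- z) + k\<^sub>3 * exp z + k\<^sub>4 * exp (2 * z)"
    and z: "z \<in> I"
  shows "L_defect 1 z = 6 * k\<^sub>1 * exp (- 2 * z) + 3 * k\<^sub>2 * exp (- z)"
    "L_defect (- 1) z = 3 * k\<^sub>3 * exp z + 6 * k\<^sub>4 * exp (2 * z)"
proof -
  have F1: "F1 z = - 2 * k\<^sub>1 * exp (- 2 * z) - k\<^sub>2 * exp (- z) + k\<^sub>3 * exp z + 2 * k\<^sub>4 * exp (2 * z)"
    if "z \<in> I" for z
    by (rule deriv_eqI_on_open[OF open_I that F[rule_format]]) (auto intro!: derivative_eq_intros)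
  have F2: "F2 z = 4 * k\<^sub>1 * exp (- 2 * z) + k\<^sub>2 * exp (- z) + k\<^sub>3 * exp z + 4 * k\<^sub>4 * exp (2 * z)"
    by (rule deriv_eqI_on_open[OF open_I z F1]) (auto intro!: derivative_eq_intros)
  show "L_defect 1 z = 6 * k\<^sub>1 * exp (- 2 * z) + 3 * k\<^sub>2 * exp (- z)"
    "L_defect (- 1) z = 3 * k\<^sub>3 * exp z + 6 * k\<^sub>4 * exp (2 * z)"
    using F z by (simp_all add: L_defect_def F1[OF z] F2 field_simps)
qed

text \<open>
  For \<open>C = C\<^sub>0 exp (-z)\<close> the factor \<open>\<surd>C\<close> contributes \<open>exp (-z/2)\<close>, leaving a linear equation for \<open>F\<close> with
  constant coefficients and an exponential source: \<open>exp (-z)\<close> for \<open>\<epsilon> = 1\<close> and \<open>exp (2z)\<close> for \<open>\<epsilon> = -1\<close>.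
\<close>

lemma divergence_free_kaehler_iff:
  assumes \<epsilon>: "\<epsilon> = 1 \<or> \<epsilon> = - 1" and "is_interval I"
    and C: "\<forall>z\<in>I. C z = C\<^sub>0 * exp (- z)" and "C\<^sub>0 > 0"
  shows "divergence_free_on (I_times_S3 I) g (weyl_part \<epsilon>) \<longleftrightarrow>
    (\<exists>K. \<forall>z\<in>I. L_defect \<epsilon> z = K * exp ((1 - 3 * \<epsilon>) / 2 * z))"
proof -
  have "exp (3 / 2 * \<epsilon> * z) * L_defect \<epsilon> z * sqrt (C z)
      = sqrt C\<^sub>0 * (L_defect \<epsilon> z / exp ((1 - 3 * \<epsilon>) / 2 * z))" if "z \<in> I" for z
  proof -
    have "sqrt (exp (- z)) = exp (- z / 2)"
      by (rule real_sqrt_unique) (simp_all flip: exp_of_nat_mult)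
    moreover have "exp (3 / 2 * \<epsilon> * z) * exp (- z / 2) = inverse (exp ((1 - 3 * \<epsilon>) / 2 * z))"
      unfolding exp_minus[symmetric] exp_add[symmetric] by (rule arg_cong) (simp add: field_simps)
    moreover have "exp (3 / 2 * \<epsilon> * z) * L_defect \<epsilon> z * sqrt (C z)
        = sqrt C\<^sub>0 * (L_defect \<epsilon> z * (exp (3 / 2 * \<epsilon> * z) * sqrt (exp (- z))))"
      using C that by (simp add: real_sqrt_mult)
    ultimately show ?thesis
      by (simp only: divide_inverse)
  qed
  then have "(\<lambda>z. exp (3 / 2 * \<epsilon> * z) * L_defect \<epsilon> z * sqrt (C z)) constant_on I
      \<longleftrightarrow> (\<exists>k. \<forall>z\<in>I. sqrt C\<^sub>0 * (L_defect \<epsilon> z / exp ((1 - 3 * \<epsilon>) / 2 * z)) = k)"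
    by (simp add: constant_on_def)
  also have "\<dots> \<longleftrightarrow> (\<exists>K. \<forall>z\<in>I. L_defect \<epsilon> z = K * exp ((1 - 3 * \<epsilon>) / 2 * z))"
  proof
    assume "\<exists>k. \<forall>z\<in>I. sqrt C\<^sub>0 * (L_defect \<epsilon> z / exp ((1 - 3 * \<epsilon>) / 2 * z)) = k"
    then obtain k where "\<forall>z\<in>I. sqrt C\<^sub>0 * (L_defect \<epsilon> z / exp ((1 - 3 * \<epsilon>) / 2 * z)) = k" ..
    then have "\<forall>z\<in>I. L_defect \<epsilon> z = k / sqrt C\<^sub>0 * exp ((1 - 3 * \<epsilon>) / 2 * z)"
      using \<open>C\<^sub>0 > 0\<close> by (auto simp: field_simps)
    then show "\<exists>K. \<forall>z\<in>I. L_defect \<epsilon> z = K * exp ((1 - 3 * \<epsilon>) / 2 * z)" by blast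
  next
    assume "\<exists>K. \<forall>z\<in>I. L_defect \<epsilon> z = K * exp ((1 - 3 * \<epsilon>) / 2 * z)"
    then show "\<exists>k. \<forall>z\<in>I. sqrt C\<^sub>0 * (L_defect \<epsilon> z / exp ((1 - 3 * \<epsilon>) / 2 * z)) = k" by auto
  qed
  finally show ?thesis
    using divergence_free_iff[OF \<epsilon> \<open>is_interval I\<close>] by simp
qed

text \<open>
  Since \<open>\<L>\<^sup>+ exp (-z) = 3 exp (-z)\<close>, subtracting \<open>1 + K/3 exp (-z)\<close> from \<open>F\<close> leaves a homogeneous
  equation with roots 1 and 2.
\<close>

lemma L_plus_exponential_iff:
  assumes "is_interval I"
  shows "(\<exists>K. \<forall>z\<in>I. L_defect 1 z = K * exp (- z)) \<longleftrightarrow>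
    (\<exists>C\<^sub>2 C\<^sub>3 C\<^sub>4. \<forall>z\<in>I. F z = 1 + C\<^sub>2 * exp (- z) + C\<^sub>3 * exp z + (1/2) * C\<^sub>4 * exp (2 * z))"
proof
  assume "\<exists>K. \<forall>z\<in>I. L_defect 1 z = K * exp (- z)"
  then obtain K where K: "\<And>z. z \<in> I \<Longrightarrow> L_defect 1 z = K * exp (- z)" by blast
  have "\<exists>A B. \<forall>z\<in>I. F z - 1 - K / 3 * exp (- z) = A * exp (1 * z) + B * exp (2 * z)"
  proof (rule linear_ode_two_exponentials[OF open_I assms])
    fix z assume z: "z \<in> I"
    show "((\<lambda>z. F z - 1 - K / 3 * exp (- z)) has_real_derivative F1 z + K / 3 * exp (- z)) (at z)"
      "((\<lambda>z. F1 z + K / 3 * exp (- z)) has_real_derivative F2 z - K / 3 * exp (- z)) (at z)"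
      by (auto intro!: derivative_eq_intros F_derivs[OF z])
    show "F2 z - K / 3 * exp (- z) - (1 + 2) * (F1 z + K / 3 * exp (- z))
        + 1 * 2 * (F z - 1 - K / 3 * exp (- z)) = 0"
      using K[OF z] by (simp add: L_defect_def)
  qed simp
  then obtain A B where "\<forall>z\<in>I. F z - 1 - K / 3 * exp (- z) = A * exp (1 * z) + B * exp (2 * z)" by blast
  then have "\<forall>z\<in>I. F z = 1 + (K / 3) * exp (- z) + A * exp z + (1/2) * (2 * B) * exp (2 * z)"
    by (auto simp: algebra_simps)
  then show "\<exists>C\<^sub>2 C\<^sub>3 C\<^sub>4. \<forall>z\<in>I. F z = 1 + C\<^sub>2 * exp (- z) + C\<^sub>3 * exp z + (1/2) * C\<^sub>4 * exp (2 * z)"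
    by blast
next
  assume "\<exists>C\<^sub>2 C\<^sub>3 C\<^sub>4. \<forall>z\<in>I. F z = 1 + C\<^sub>2 * exp (- z) + C\<^sub>3 * exp z + (1/2) * C\<^sub>4 * exp (2 * z)"
  then obtain C\<^sub>2 C\<^sub>3 C\<^sub>4 where
    "\<forall>z\<in>I. F z = 1 + 0 * exp (- 2 * z) + C\<^sub>2 * exp (- z) + C\<^sub>3 * exp z + ((1/2) * C\<^sub>4) * exp (2 * z)"
    by auto
  from L_defect_exponential_sum(1)[OF this]
  have "\<forall>z\<in>I. L_defect 1 z = (3 * C\<^sub>2) * exp (- z)" by simp
  then show "\<exists>K. \<forall>z\<in>I. L_defect 1 z = K * exp (- z)" by blast
qed

text \<open>
  Since \<open>\<L>\<^sup>- exp (2z) = 6 exp (2z)\<close>, subtracting \<open>1 + K/6 exp (2z)\<close> from \<open>F\<close> leaves a homogeneous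
  equation with roots -1 and -2.
\<close>

lemma L_minus_exponential_iff:
  assumes "is_interval I"
  shows "(\<exists>K. \<forall>z\<in>I. L_defect (- 1) z = K * exp (2 * z)) \<longleftrightarrow>
    (\<exists>C\<^sub>1 C\<^sub>2 C\<^sub>4. \<forall>z\<in>I. F z = 1 + (1/2) * C\<^sub>1 * exp (- 2 * z) + C\<^sub>2 * exp (- z) + (1/2) * C\<^sub>4 * exp (2 * z))"
proof
  assume "\<exists>K. \<forall>z\<in>I. L_defect (- 1) z = K * exp (2 * z)"
  then obtain K where K: "\<And>z. z \<in> I \<Longrightarrow> L_defect (- 1) z = K * exp (2 * z)" by blast
  have "\<exists>A B. \<forall>z\<in>I. F z - 1 - K / 6 * exp (2 * z) = A * exp ((- 1) * z) + B * exp ((- 2) * z)"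
  proof (rule linear_ode_two_exponentials[OF open_I assms])
    fix z assume z: "z \<in> I"
    show "((\<lambda>z. F z - 1 - K / 6 * exp (2 * z)) has_real_derivative F1 z - K / 3 * exp (2 * z)) (at z)"
      "((\<lambda>z. F1 z - K / 3 * exp (2 * z)) has_real_derivative F2 z - 2 * K / 3 * exp (2 * z)) (at z)"
      by (auto intro!: derivative_eq_intros F_derivs[OF z])
    show "F2 z - 2 * K / 3 * exp (2 * z) - (- 1 + - 2) * (F1 z - K / 3 * exp (2 * z))
        + - 1 * - 2 * (F z - 1 - K / 6 * exp (2 * z)) = 0"
      using K[OF z] by (simp add: L_defect_def)
  qed simp
  then obtain A B where
    "\<forall>z\<in>I. F z - 1 - K / 6 * exp (2 * z) = A * exp ((- 1) * z) + B * exp ((- 2) * z)" by blast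
  then have "\<forall>z\<in>I. F z = 1 + (1/2) * (2 * B) * exp (- 2 * z) + A * exp (- z) + (1/2) * (K / 3) * exp (2 * z)"
    by (auto simp: algebra_simps)
  then show "\<exists>C\<^sub>1 C\<^sub>2 C\<^sub>4. \<forall>z\<in>I. F z = 1 + (1/2) * C\<^sub>1 * exp (- 2 * z) + C\<^sub>2 * exp (- z) + (1/2) * C\<^sub>4 * exp (2 * z)"
    by blast
next
  assume "\<exists>C\<^sub>1 C\<^sub>2 C\<^sub>4. \<forall>z\<in>I. F z = 1 + (1/2) * C\<^sub>1 * exp (- 2 * z) + C\<^sub>2 * exp (- z) + (1/2) * C\<^sub>4 * exp (2 * z)"
  then obtain C\<^sub>1 C\<^sub>2 C\<^sub>4 where
    "\<forall>z\<in>I. F z = 1 + ((1/2) * C\<^sub>1) * exp (- 2 * z) + C\<^sub>2 * exp (- z) + 0 * exp z + ((1/2) * C\<^sub>4) * exp (2 * z)"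
    by auto
  from L_defect_exponential_sum(2)[OF this]
  have "\<forall>z\<in>I. L_defect (- 1) z = (3 * C\<^sub>4) * exp (2 * z)" by simp
  then show "\<exists>K. \<forall>z\<in>I. L_defect (- 1) z = K * exp (2 * z)" by blast
qed

text \<open>
  The field \<open>e\<^sub>1\<close> rotates \<open>e\<^sub>2\<close> and \<open>e\<^sub>3\<close> into each other and commutes with \<open>e\<^sub>0\<close>; as \<open>\<eta>\<^sup>2\<close> and \<open>\<eta>\<^sup>3\<close> have the
  same weight, the metric is invariant.
\<close>

lemma killing_multiple_e1:
  assumes X: "\<And>p. fst p \<in> I \<Longrightarrow> X p = axis 1 k"
  shows "killing_on (I_times_S3 I) g X"
proof -
  have lie: "lie_bracket X (\<lambda>_. axis b 1) p $ c
      = frame_bracket (\<lambda>c. if c = 1 then k else 0) (\<lambda>_. 0) (\<lambda>c. if c = b then 1 else 0) (\<lambda>_. 0) c"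
    if p: "fst p \<in> I" for p b c
  proof (rule lie_bracket_eq)
    show "X p $ c = (if c = 1 then k else 0)" for c
      by (simp add: X[OF p] axis_def)
    show "frame_deriv e (\<lambda>q. X q $ c) p = (if e = 0 then 0 else 0)" for e c
      by (rule frame_deriv_eq[OF p, of _ "\<lambda>_. axis 1 k $ c"]) (simp_all add: X)
  qed (simp_all add: axis_def frame_deriv_const)
  have "\<forall>a b. (\<Sum>c\<in>UNIV. X p $ c * frame_deriv c (\<lambda>q. g q $ a $ b) p)
     - (\<Sum>c\<in>UNIV. lie_bracket X (\<lambda>_. axis a 1) p $ c * g p $ c $ b)
     - (\<Sum>c\<in>UNIV. lie_bracket X (\<lambda>_. axis b 1) p $ c * g p $ a $ c) = 0" if p: "fst p \<in> I" for p
    unfolding frame_deriv_g[OF p] lie[OF p] X[OF p] unfolding g_eq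
    by (intro all_index_I; simp add: frame_bracket_def sum_index axis_def struct_const_def weight_def base_weight_def)
  then show ?thesis
    unfolding killing_on_def by (blast dest: fst_I_times_S3)
qed

text \<open>
  In general \<open>J\<nabla>s = (2 s'/C) e\<^sub>1\<close>. The coefficient is constant as soon as \<open>s'\<close> is a multiple of
  \<open>exp (-z)\<close>, that is, of \<open>C\<close>.
\<close>

lemma J_gradient_scal:
  assumes C: "\<forall>z\<in>I. C z = C\<^sub>0 * exp (- z)" and "C\<^sub>0 > 0"
    and s: "\<And>z. z \<in> I \<Longrightarrow> scalar z = \<alpha> * exp (- z) + \<beta>" and p: "fst p \<in> I"
  shows "J p *v gradient g (scal g) p = axis 1 (- 2 * \<alpha> / C\<^sub>0)"
proof -
  have "frame_deriv e (scal g) p = (if e = 0 then - \<alpha> * exp (- fst p) else 0)" for e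
    by (rule frame_deriv_eq[OF p, of _ "\<lambda>z. \<alpha> * exp (- z) + \<beta>"])
       (auto simp: scal_eq s intro!: derivative_eq_intros)
  then have "gradient g (scal g) p $ a = (if a = 0 then - 4 * \<alpha> * F (fst p) / C\<^sub>0 else 0)" for a
    using C p F_nz[OF p] \<open>C\<^sub>0 > 0\<close>
    by (simp add: gradient_def g_inv_eq[OF p] sum_index weight_def base_weight_def)
  then have "\<forall>a. (J p *v gradient g (scal g) p) $ a = axis 1 (- 2 * \<alpha> / C\<^sub>0) $ a"
    using F_nz[OF p]
    by (intro all_index_I; simp add: matrix_vector_mult_def sum_index cplx_struct_eq cplx_coeff_def axis_def)
  then show ?thesis by (simp add: vec_eq_iff)
qed

end

theorem proposition1p4:
  fixes I :: "real set" and F C :: "real \<Rightarrow> real"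
  assumes "open I" and "is_interval I" and "I \<noteq> {}"
    and "smooth_on_line I F" and "smooth_on_line I C"
    and "\<forall>z\<in>I. F z > 0" and "\<forall>z\<in>I. C z > 0"
  shows
    "(\<forall>s\<^sub>0::real. (\<forall>p\<in>I_times_S3 I. scal (biaxial_metric F C) p = s\<^sub>0) \<longleftrightarrow>
        (\<forall>z\<in>I. 0 = s\<^sub>0 * C z powr (3/2)
                  + 4 * C z powr (1/2) * (deriv (deriv F) z + (1/2) * F z - 2)
                  + 24 * deriv (\<lambda>y. F y * deriv (\<lambda>x. C x powr (1/2)) y) z))
   \<and> (divergence_free_on (I_times_S3 I) (biaxial_metric F C) (weyl_plus (biaxial_metric F C)) \<longleftrightarrow>
        (\<lambda>z. exp ((3/2) * z) * (L_plus F z - 1) * sqrt (C z)) constant_on I)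
   \<and> (divergence_free_on (I_times_S3 I) (biaxial_metric F C) (weyl_minus (biaxial_metric F C)) \<longleftrightarrow>
        (\<lambda>z. exp (- (3/2) * z) * (L_minus F z - 1) * sqrt (C z)) constant_on I)
   \<and> (kaehler_on (I_times_S3 I) (biaxial_metric F C) (cplx_struct F) \<longleftrightarrow>
        (\<exists>C\<^sub>0>0. \<forall>z\<in>I. C z = C\<^sub>0 * exp (- z)))
   \<and> (\<forall>C\<^sub>0>0. (\<forall>z\<in>I. C z = C\<^sub>0 * exp (- z)) \<longrightarrow>
        (divergence_free_on (I_times_S3 I) (biaxial_metric F C) (weyl_plus (biaxial_metric F C)) \<longleftrightarrow>
           (\<exists>C\<^sub>2 C\<^sub>3 C\<^sub>4. \<forall>z\<in>I.
              F z = 1 + C\<^sub>2 * exp (- z) + C\<^sub>3 * exp z + (1/2) * C\<^sub>4 * exp (2 * z)))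
      \<and> (\<forall>C\<^sub>2 C\<^sub>3 C\<^sub>4.
           (\<forall>z\<in>I. F z = 1 + C\<^sub>2 * exp (- z) + C\<^sub>3 * exp z + (1/2) * C\<^sub>4 * exp (2 * z)) \<longrightarrow>
           (\<forall>p\<in>I_times_S3 I. scal (biaxial_metric F C) p = - 24 * C\<^sub>2 / C\<^sub>0))
      \<and> (divergence_free_on (I_times_S3 I) (biaxial_metric F C) (weyl_minus (biaxial_metric F C)) \<longleftrightarrow>
           (\<exists>C\<^sub>1 C\<^sub>2 C\<^sub>4. \<forall>z\<in>I.
              F z = 1 + (1/2) * C\<^sub>1 * exp (- 2 * z) + C\<^sub>2 * exp (- z) + (1/2) * C\<^sub>4 * exp (2 * z)))
      \<and> (\<forall>C\<^sub>1 C\<^sub>2 C\<^sub>4.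
           (\<forall>z\<in>I. F z = 1 + (1/2) * C\<^sub>1 * exp (- 2 * z) + C\<^sub>2 * exp (- z) + (1/2) * C\<^sub>4 * exp (2 * z)) \<longrightarrow>
           extremal_kaehler_on (I_times_S3 I) (biaxial_metric F C) (cplx_struct F) \<and>
           (\<forall>p\<in>I_times_S3 I.
              scal (biaxial_metric F C) p = - (24 / C\<^sub>0) * (C\<^sub>1 * exp (- fst p) + C\<^sub>2))))"
proof -
  interpret biaxial I F C
    by unfold_locales (use assms in auto)
  have plus: "divergence_free_on (I_times_S3 I) g (weyl_plus g) \<longleftrightarrow>
      (\<lambda>z. exp ((3/2) * z) * (L_plus F z - 1) * sqrt (C z)) constant_on I"
    unfolding weyl_parts divergence_free_iff[OF disjI1[OF refl] \<open>is_interval I\<close>]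
    by (simp add: constant_on_def L_ops_eq)
  have minus: "divergence_free_on (I_times_S3 I) g (weyl_minus g) \<longleftrightarrow>
      (\<lambda>z. exp (- (3/2) * z) * (L_minus F z - 1) * sqrt (C z)) constant_on I"
    unfolding weyl_parts divergence_free_iff[OF disjI2[OF refl] \<open>is_interval I\<close>]
    by (simp add: constant_on_def L_ops_eq)
  have kaehler: "(divergence_free_on (I_times_S3 I) g (weyl_plus g) \<longleftrightarrow>
           (\<exists>C\<^sub>2 C\<^sub>3 C\<^sub>4. \<forall>z\<in>I.
              F z = 1 + C\<^sub>2 * exp (- z) + C\<^sub>3 * exp z + (1/2) * C\<^sub>4 * exp (2 * z)))
      \<and> (\<forall>C\<^sub>2 C\<^sub>3 C\<^sub>4.
           (\<forall>z\<in>I. F z = 1 + C\<^sub>2 * exp (- z) + C\<^sub>3 * exp z + (1/2) * C\<^sub>4 * exp (2 * z)) \<longrightarrow>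
           (\<forall>p\<in>I_times_S3 I. scal g p = - 24 * C\<^sub>2 / C\<^sub>0))
      \<and> (divergence_free_on (I_times_S3 I) g (weyl_minus g) \<longleftrightarrow>
           (\<exists>C\<^sub>1 C\<^sub>2 C\<^sub>4. \<forall>z\<in>I.
              F z = 1 + (1/2) * C\<^sub>1 * exp (- 2 * z) + C\<^sub>2 * exp (- z) + (1/2) * C\<^sub>4 * exp (2 * z)))
      \<and> (\<forall>C\<^sub>1 C\<^sub>2 C\<^sub>4.
           (\<forall>z\<in>I. F z = 1 + (1/2) * C\<^sub>1 * exp (- 2 * z) + C\<^sub>2 * exp (- z) + (1/2) * C\<^sub>4 * exp (2 * z)) \<longrightarrow>
           extremal_kaehler_on (I_times_S3 I) g J \<and>
           (\<forall>p\<in>I_times_S3 I. scal g p = - (24 / C\<^sub>0) * (C\<^sub>1 * exp (- fst p) + C\<^sub>2)))"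
    if C\<^sub>0: "C\<^sub>0 > 0" and C: "\<forall>z\<in>I. C z = C\<^sub>0 * exp (- z)" for C\<^sub>0
  proof (intro conjI allI impI)
    show "divergence_free_on (I_times_S3 I) g (weyl_plus g) \<longleftrightarrow>
           (\<exists>C\<^sub>2 C\<^sub>3 C\<^sub>4. \<forall>z\<in>I.
              F z = 1 + C\<^sub>2 * exp (- z) + C\<^sub>3 * exp z + (1/2) * C\<^sub>4 * exp (2 * z))"
      unfolding weyl_parts divergence_free_kaehler_iff[OF disjI1[OF refl] \<open>is_interval I\<close> C C\<^sub>0]
        L_plus_exponential_iff[OF \<open>is_interval I\<close>, symmetric] by simp
    show "divergence_free_on (I_times_S3 I) g (weyl_minus g) \<longleftrightarrow>
           (\<exists>C\<^sub>1 C\<^sub>2 C\<^sub>4. \<forall>z\<in>I.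
              F z = 1 + (1/2) * C\<^sub>1 * exp (- 2 * z) + C\<^sub>2 * exp (- z) + (1/2) * C\<^sub>4 * exp (2 * z))"
      unfolding weyl_parts divergence_free_kaehler_iff[OF disjI2[OF refl] \<open>is_interval I\<close> C C\<^sub>0]
        L_minus_exponential_iff[OF \<open>is_interval I\<close>, symmetric] by simp
  next
    fix C\<^sub>2 C\<^sub>3 C\<^sub>4
    assume "\<forall>z\<in>I. F z = 1 + C\<^sub>2 * exp (- z) + C\<^sub>3 * exp z + (1/2) * C\<^sub>4 * exp (2 * z)"
    then have "\<forall>z\<in>I. F z = 1 + 0 * exp (- 2 * z) + C\<^sub>2 * exp (- z) + C\<^sub>3 * exp z + ((1/2) * C\<^sub>4) * exp (2 * z)"
      by simp
    note L = L_defect_exponential_sum(1)[OF this]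
    show "\<forall>p\<in>I_times_S3 I. scal g p = - 24 * C\<^sub>2 / C\<^sub>0"
      by (simp add: fst_I_times_S3 scal_eq scalar_kaehler[OF C C\<^sub>0] L exp_minus)
  next
    fix C\<^sub>1 C\<^sub>2 C\<^sub>4
    assume "\<forall>z\<in>I. F z = 1 + (1/2) * C\<^sub>1 * exp (- 2 * z) + C\<^sub>2 * exp (- z) + (1/2) * C\<^sub>4 * exp (2 * z)"
    then have "\<forall>z\<in>I. F z = 1 + ((1/2) * C\<^sub>1) * exp (- 2 * z) + C\<^sub>2 * exp (- z) + 0 * exp z + ((1/2) * C\<^sub>4) * exp (2 * z)"
      by simp
    note L = L_defect_exponential_sum(1)[OF this]
    have s: "scalar z = (- 24 * C\<^sub>1 / C\<^sub>0) * exp (- z) + (- 24 * C\<^sub>2 / C\<^sub>0)" if "z \<in> I" for z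
    proof -
      have "exp (- 2 * z) * exp z = exp (- z)" "exp (- z) * exp z = 1"
        by (simp_all flip: exp_add)
      moreover have "- 8 * (6 * ((1/2) * C\<^sub>1) * x + 3 * C\<^sub>2 * y) * w / C\<^sub>0
          = (- 24 * C\<^sub>1 / C\<^sub>0) * (x * w) + (- 24 * C\<^sub>2 / C\<^sub>0) * (y * w)" for x y w :: real
        by (simp add: algebra_simps add_divide_distrib diff_divide_distrib)
      ultimately show ?thesis
        unfolding scalar_kaehler[OF C C\<^sub>0 that] L[OF that] by simp
    qed
    show "\<forall>p\<in>I_times_S3 I. scal g p = - (24 / C\<^sub>0) * (C\<^sub>1 * exp (- fst p) + C\<^sub>2)"
      by (simp add: fst_I_times_S3 scal_eq s distrib_left add_divide_distrib)
    have "kaehler_on (I_times_S3 I) g J"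
      unfolding kaehler_iff[OF \<open>is_interval I\<close> \<open>I \<noteq> {}\<close>] using C\<^sub>0 C by blast
    moreover have "killing_on (I_times_S3 I) g (\<lambda>p. J p *v gradient g (scal g) p)"
      by (rule killing_multiple_e1) (rule J_gradient_scal[OF C C\<^sub>0 s])
    ultimately show "extremal_kaehler_on (I_times_S3 I) g J"
      by (simp add: extremal_kaehler_on_def)
  qed
  show ?thesis
    by (intro conjI[OF allI[OF scal_const_iff] conjI[OF plus conjI[OF minus
          conjI[OF kaehler_iff[OF \<open>is_interval I\<close> \<open>I \<noteq> {}\<close>]]]]] allI impI kaehler)
qed

end
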